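(* Let $q\geq 3$ be a prime power, $m\geq 4$, $n=\frac{q^m-1}{q-1}$, and $2\le\delta\le n$. Then $\mathcal{C}_{(q,n,\delta,2)}$ is a dually-BCH code if and only if $$\frac{q^{m}-1-\sum_{t=1}^{q-1}q^{\left\lceil \frac{mt}{q-1}-1\right\rceil}}{q-1}\leq\delta\leq n-1.$$
   Context: Let $\alpha$ be a generator of $\mathbb{F}_{q^{m}}^*$ and $\beta_2=\alpha^{q-1}$, a primitive $n$-th root of unity. For an integer $j$ (read modulo $n$) let $m_j(x)$ be the minimal polynomial of $\beta_2^j$ over $\mathbb{F}_q$. For integers $b\ge 1$ and $2\le\delta\le n$, the BCH code $\mathcal{C}_{(q,n,\delta,b)}$ with respect to $\beta_2$ is the cyclic code of length $n$ over $\mathbb{F}_q$ (an ideal of $\mathbb{F}_q[x]/\langle x^n-1\rangle$) generated by $\mathrm{lcm}(m_b(x),m_{b+1}(x),\dots,m_{b+\delta-2}(x))$. A BCH code is called dually-BCH if its dual code (with respect to the standard inner product) is again a BCH code $\mathcal{C}_{(q,n,\delta',b')}$ with respect to the same primitive $n$-th root of unity, for some $b'$ and $\delta'$. *)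

theory Defs
  imports
    Complex_Main
    "HOL-Library.Cardinality"
    "HOL-Computational_Algebra.Computational_Algebra"
    "HOL-Number_Theory.Prime_Powers"
begin

text \<open>
  A field extension is given by two field types and an embedding \<open>h\<close> of the small field
  \<open>'k\<close> into the large field \<open>'l\<close>. The sort \<open>field_gcd\<close> on \<open>'k\<close> puts no condition on the field:
  it only supplies the (trivial) gcd and normalization operations that the library needs in order
  to provide \<open>Lcm\<close> on \<open>'k poly\<close>.
\<close>

definition field_embedding :: "('k::field \<Rightarrow> 'l::field) \<Rightarrow> bool" where
  "field_embedding h \<longleftrightarrow>
     h 0 = 0 \<and> h 1 = 1 \<and>
     (\<forall>x y. h (x + y) = h x + h y) \<and> (\<forall>x y. h (x * y) = h x * h y)"

definition generates_units :: "'l::field \<Rightarrow> bool" where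
  "generates_units \<alpha> \<longleftrightarrow> \<alpha> \<noteq> 0 \<and> (\<forall>x. x \<noteq> 0 \<longrightarrow> (\<exists>k::nat. x = \<alpha> ^ k))"

definition min_poly :: "('k::field \<Rightarrow> 'l::field) \<Rightarrow> 'l \<Rightarrow> 'k poly" where
  "min_poly h x = (THE p. lead_coeff p = 1 \<and> poly (map_poly h p) x = 0 \<and>
     (\<forall>r. r \<noteq> 0 \<and> poly (map_poly h r) x = 0 \<longrightarrow> degree p \<le> degree r))"

text \<open>
  A residue class in \<open>'k[x] / (x ^ n - 1)\<close> is represented by its unique member of degree less
  than \<open>n\<close>, and a vector \<open>(c\<^sub>0, \<dots>, c\<^bsub>n-1\<^esub>)\<close> is identified with the polynomial having these
  coefficients. So a code of length \<open>n\<close> is a set of polynomials of degree less than \<open>n\<close>, for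
  \<open>n \<ge> 1\<close>. The next definition is the ideal generated by \<open>g\<close> in the quotient ring.
\<close>

definition cyclic_code :: "nat \<Rightarrow> 'k::field poly \<Rightarrow> 'k poly set" where
  "cyclic_code n g = {(a * g) mod (monom 1 n - 1) | a. True}"

definition dual_code :: "nat \<Rightarrow> 'k::field poly set \<Rightarrow> 'k poly set" where
  "dual_code n C = {d. degree d < n \<and> (\<forall>c\<in>C. (\<Sum>i<n. coeff c i * coeff d i) = 0)}"

definition bch_code ::
  "('k::field_gcd \<Rightarrow> 'l::field) \<Rightarrow> 'l \<Rightarrow> nat \<Rightarrow> nat \<Rightarrow> nat \<Rightarrow> 'k poly set" where
  "bch_code h \<beta> n \<delta> b = cyclic_code n (Lcm ((\<lambda>j. min_poly h (\<beta> ^ j)) ` {b..b + \<delta> - 2}))"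

definition dually_bch ::
  "('k::field_gcd \<Rightarrow> 'l::field) \<Rightarrow> 'l \<Rightarrow> nat \<Rightarrow> 'k poly set \<Rightarrow> bool" where
  "dually_bch h \<beta> n C \<longleftrightarrow>
     (\<exists>\<delta>' b'. 2 \<le> \<delta>' \<and> \<delta>' \<le> n \<and> 1 \<le> b' \<and> dual_code n C = bch_code h \<beta> n \<delta>' b')"

end

theory Submission
  imports Defs "HOL-Number_Theory.Cong"
begin

text \<open>
  Identify a code with the set of exponents of its zeros, a subset of \<open>\<int> / n\<close> closed under
  multiplication by \<open>q\<close>; the dual code then has as zeros the complement of the negated set.
  The numbers \<open>e\<^sub>i = \<lfloor>q (j q\<^sup>i mod n) / n\<rfloor>\<close> are the base-\<open>q\<close> digits of \<open>(q - 1) j\<close>, and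
  multiplying \<open>j\<close> by \<open>q\<close> rotates them. By the cycle lemma a digit word whose sum is at least
  \<open>q - 1\<close> has a rotation whose prefix sums are at least \<open>\<lceil>r (q - 1) / m\<rceil>\<close>, so the balanced word
  with exactly these prefix sums gives the least number \<open>\<nu>\<close> that is the maximum of a nonzero
  coset, and \<open>n - \<nu>\<close> is the largest coset leader. If \<open>n - \<nu> \<le> \<delta> < n\<close>, the dual has the only
  zero exponent \<open>0\<close>. If \<open>\<delta> < n - \<nu>\<close>, an interval of exponents generating the zeros of the dual
  contains a multiple of \<open>n\<close> and is confined by the zeros of the code, so it cannot reach every
  coset: the missed one is that of \<open>\<nu>\<close>, of a word with all digits in the middle, or of \<open>n - \<nu>\<close>.
\<close>

subsection \<open>Digit expansions\<close>

primrec horner :: "nat \<Rightarrow> (nat \<Rightarrow> nat) \<Rightarrow> nat \<Rightarrow> nat" where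
  "horner q e 0 = 0"
| "horner q e (Suc r) = q * horner q e r + e r"

lemma horner_shift: "horner q e (Suc r) = e 0 * q ^ r + horner q (\<lambda>i. e (Suc i)) r"
  by (induction r) (auto simp: algebra_simps)

lemma horner_sum: "horner q e k = (\<Sum>i<k. e i * q ^ (k - 1 - i))"
proof (induction k)
  case (Suc k)
  have "q * (\<Sum>i<k. e i * q ^ (k - 1 - i)) = (\<Sum>i<k. e i * q ^ (k - i))"
    unfolding sum_distrib_left
  proof (rule sum.cong[OF refl])
    fix i assume "i \<in> {..<k}"
    then have "k - i = Suc (k - 1 - i)" by auto
    then show "q * (e i * q ^ (k - 1 - i)) = e i * q ^ (k - i)" by simp
  qed
  with Suc show ?case by simp
qed simp

text \<open>Summation by parts: the value of a word is a combination of its prefix sums with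
  nonnegative coefficients.\<close>

lemma horner_mono_prefix:
  assumes "q > 0" "\<And>r. r \<le> k \<Longrightarrow> (\<Sum>i<r. e' i) \<le> (\<Sum>i<r. e i)"
  shows "horner q e' k \<le> horner q e k"
proof -
  obtain q0 where q0: "q = Suc q0"
    using assms(1) gr0_implies_Suc by blast
  \<comment> \<open>Strengthened for the induction: value minus digit sum is compared, written
    without subtraction, because the newest digit cancels in that difference.\<close>
  have "horner q e' k + (\<Sum>i<k. e i) \<le> horner q e k + (\<Sum>i<k. e' i)"
    using assms(2)
  proof (induction k)
    case (Suc k)
    have 1: "horner q e' k + (\<Sum>i<k. e i) \<le> horner q e k + (\<Sum>i<k. e' i)"
      using Suc by simp
    moreover have "(\<Sum>i<k. e' i) \<le> (\<Sum>i<k. e i)"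
      using Suc.prems[of k] by simp
    ultimately have "q0 * horner q e' k \<le> q0 * horner q e k"
      by (intro mult_left_mono) auto
    with 1 show ?case
      unfolding horner.simps sum.lessThan_Suc q0 mult_Suc by linarith
  qed simp
  with assms(2)[of k] show ?thesis by simp
qed

text \<open>The constant word \<open>c\<close> has value \<open>c * (q ^ k - 1) / (q - 1)\<close>;
  the inequality is cleared of division and subtraction.\<close>

lemma horner_le:
  assumes "q > 0" "\<And>i. e i \<le> c"
  shows "horner q e k * (q - 1) + c \<le> c * q ^ k"
proof (induction k)
  case (Suc k)
  obtain q0 where q0: "q = Suc q0"
    using assms(1) gr0_implies_Suc by blast
  have "horner q e (Suc k) * (q - 1) + c = q * (horner q e k * q0) + e k * q0 + c"
    by (simp add: q0 algebra_simps)
  also have "\<dots> \<le> q * (horner q e k * q0) + c * q0 + c"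
    using assms(2) by simp
  also have "\<dots> = q * (horner q e k * (q - 1) + c)"
    by (simp add: q0 algebra_simps)
  also have "\<dots> \<le> q * (c * q ^ k)"
    using Suc by (rule mult_left_mono) simp
  finally show ?case by (simp add: algebra_simps)
qed simp

text \<open>Each of the first \<open>r\<close> digits has weight at least \<open>q ^ d\<close> in a
  word of length \<open>r + d\<close>.\<close>

lemma sum_mult_power_le_horner:
  assumes "q > 0"
  shows "(\<Sum>i<r. e i) * q ^ d \<le> horner q e (r + d)"
proof (induction d)
  case 0
  show ?case
  proof (induction r)
    case (Suc r)
    have "horner q e (r + 0) \<le> q * horner q e (r + 0)"
      using assms by simp
    with Suc show ?case
      unfolding horner.simps sum.lessThan_Suc add_0_right power_0 mult_1_right by linarith
  qed simp
next
  case (Suc d)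
  have "(\<Sum>i<r. e i) * q ^ Suc d = q * ((\<Sum>i<r. e i) * q ^ d)"
    by simp
  also have "\<dots> \<le> q * horner q e (r + d)"
    using Suc by (rule mult_left_mono) simp
  also have "\<dots> \<le> horner q e (r + Suc d)"
    by simp
  finally show ?case .
qed

text \<open>Casting out \<open>q - 1\<close>: every power of \<open>q\<close> is 1 modulo
  \<open>q - 1\<close>.\<close>

lemma horner_digit_sum: "\<exists>z. horner q e k = (\<Sum>i<k. e i) + (q - 1) * z" if "q > 0"
proof (induction k)
  case (Suc k)
  then obtain z where z: "horner q e k = (\<Sum>i<k. e i) + (q - 1) * z" by auto
  have "horner q e (Suc k) = horner q e k + (q - 1) * horner q e k + e k"
    using that by (cases q) auto
  then have "horner q e (Suc k) = (\<Sum>i<Suc k. e i) + (q - 1) * (z + horner q e k)"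
    using z by (simp add: algebra_simps)
  then show ?case by blast
qed auto

lemma dvd_horner_iff:
  assumes "q > 0"
  shows "q - 1 dvd horner q e k \<longleftrightarrow> q - 1 dvd (\<Sum>i<k. e i)"
proof -
  obtain z where "horner q e k = (\<Sum>i<k. e i) + (q - 1) * z"
    using horner_digit_sum[OF assms] by blast
  then show ?thesis by (simp add: dvd_add_left_iff)
qed

lemma sum_shift_periodic:
  fixes e :: "nat \<Rightarrow> nat"
  assumes "\<And>i. e (i + m) = e i"
  shows "(\<Sum>i<k + m. e i) = (\<Sum>i<k. e i) + (\<Sum>i<m. e i)"
  using assms by (induction k) auto

lemma sum_lessThan_add:
  fixes e :: "nat \<Rightarrow> nat"
  shows "(\<Sum>i<k + r. e i) = (\<Sum>i<k. e i) + (\<Sum>i<r. e (k + i))"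
  by (induction r) auto

text \<open>The rotation starts where the walk \<open>f\<close>, prefix sum minus average slope, is
  smallest. The walk is scaled by \<open>m\<close> to avoid fractions, and integral because it can
  be negative.\<close>

lemma cycle_lemma:
  fixes e :: "nat \<Rightarrow> nat"
  assumes "m > 0" and per: "\<And>i. e (i + m) = e i"
  shows "\<exists>k. \<forall>r\<le>m. r * (\<Sum>i<m. e i) \<le> m * (\<Sum>i<r. e (k + i))"
proof -
  define S where "S = (\<Sum>i<m. e i)"
  define f where "f = (\<lambda>k. int m * int (\<Sum>i<k. e i) - int k * int S)"
  have f_per: "f (k + m) = f k" for k
    unfolding f_def sum_shift_periodic[of e m, OF per]
    by (simp add: S_def[symmetric] algebra_simps)
  have "\<exists>k\<in>{..<m}. \<forall>l\<in>{..<m}. f k \<le> f l"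
    using assms(1) arg_min_if_finite(1)[of "{..<m}" f] arg_min_least[of "{..<m}" _ f]
    by (intro bexI[of _ "arg_min_on f {..<m}"]) auto
  then obtain k where k: "k < m" "\<And>l. l < m \<Longrightarrow> f k \<le> f l"
    by auto
  have "r * S \<le> m * (\<Sum>i<r. e (k + i))" if "r \<le> m" for r
  proof -
    have "f k \<le> f (k + r)"
    proof (cases "k + r < m")
      case False
      then have "k + r = (k + r - m) + m" "k + r - m < m"
        using k(1) that by auto
      then show ?thesis
        using k(2)[of "k + r - m"] f_per[of "k + r - m"] by simp
    qed (use k in auto)
    then have "int (r * S) \<le> int (m * (\<Sum>i<r. e (k + i)))"
      unfolding f_def sum_lessThan_add by (simp add: algebra_simps)
    then show ?thesis by (simp only: of_nat_le_iff)
  qed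
  then show ?thesis unfolding S_def by blast
qed

section \<open>Ceiling division, with the divisor as first argument\<close>

definition cdiv :: "nat \<Rightarrow> nat \<Rightarrow> nat" where
  "cdiv m a = (a + m - 1) div m"

lemma cdiv_le_iff:
  assumes "m > 0"
  shows "cdiv m a \<le> b \<longleftrightarrow> a \<le> b * m"
proof -
  have "cdiv m a \<le> b \<longleftrightarrow> a + m - 1 < Suc b * m"
    unfolding cdiv_def using less_mult_imp_div_less div_less_iff_less_mult[OF assms] less_Suc_eq_le by metis
  also have "\<dots> \<longleftrightarrow> a \<le> b * m"
    using assms by auto
  finally show ?thesis .
qed

lemma le_cdiv: "m > 0 \<Longrightarrow> a \<le> cdiv m a * m"
  using cdiv_le_iff by blast

lemma cdiv_mono: "a \<le> b \<Longrightarrow> cdiv m a \<le> cdiv m b"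
  unfolding cdiv_def by (intro div_le_mono) auto

lemma cdiv_add_le: "m > 0 \<Longrightarrow> cdiv m (a + b) \<le> cdiv m a + cdiv m b"
  using le_cdiv[of m a] le_cdiv[of m b] by (simp add: cdiv_le_iff add_mult_distrib)

lemma le_cdiv_add:
  assumes "m > 0"
  shows "cdiv m a + b div m \<le> cdiv m (a + b)"
proof -
  have "a + b div m * m \<le> cdiv m (a + b) * m"
    using le_cdiv[OF assms, of "a + b"] div_times_less_eq_dividend[of b m] by linarith
  then have "a \<le> (cdiv m (a + b) - b div m) * m" "b div m \<le> cdiv m (a + b)"
    using assms by (auto simp: diff_mult_distrib) (metis add_leD2 mult_le_cancel2)
  then show ?thesis
    using cdiv_le_iff[OF assms] by (metis le_diff_conv2)
qed

lemma cdiv_add_mult: "m > 0 \<Longrightarrow> cdiv m (a + b * m) = cdiv m a + b"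
  by (simp add: cdiv_def add.commute[of a] add.assoc flip: add_diff_assoc)

subsection \<open>Cyclotomic cosets\<close>

text \<open>The union of the \<open>q\<close>-cyclotomic cosets modulo \<open>n\<close> that meet
  \<open>J\<close>. Members of \<open>J\<close> may exceed \<open>n\<close>, as exponents of a BCH
  interval can.\<close>

definition cyc_closure :: "nat \<Rightarrow> nat \<Rightarrow> nat set \<Rightarrow> nat set" where
  "cyc_closure q n J = {i * q ^ k mod n |i k. i \<in> J}"

locale cyclotomic =
  fixes q m n :: nat
  assumes n_pos: "n > 0" and m_pos: "m > 0" and q_power: "[q ^ m = 1] (mod n)"
begin

abbreviation "cl \<equiv> cyc_closure q n"

lemma cl_less: "x \<in> cl J \<Longrightarrow> x < n"
  using n_pos by (auto simp: cyc_closure_def)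

lemma cl_iff: "x \<in> cl J \<longleftrightarrow> x < n \<and> (\<exists>i\<in>J. \<exists>k. [x = i * q ^ k] (mod n))"
proof
  assume "x \<in> cl J"
  then obtain i k where "x = i * q ^ k mod n" "i \<in> J"
    by (auto simp: cyc_closure_def)
  then have "x < n" "[x = i * q ^ k] (mod n)" "i \<in> J"
    using n_pos by (auto simp: cong_def)
  then show "x < n \<and> (\<exists>i\<in>J. \<exists>k. [x = i * q ^ k] (mod n))"
    by blast
next
  assume "x < n \<and> (\<exists>i\<in>J. \<exists>k. [x = i * q ^ k] (mod n))"
  then obtain i k where "x = i * q ^ k mod n" "i \<in> J"
    by (auto simp: cong_def)
  then show "x \<in> cl J"
    unfolding cyc_closure_def by blast
qed

lemma q_power_mult: "[q ^ (m * k) = 1] (mod n)"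
  by (metis cong_pow power_mult power_one q_power)

text \<open>\<open>q ^ (m - 1)\<close> inverts \<open>q\<close> modulo \<open>n\<close>, so
  membership in a coset can be traced backwards along multiplication by \<open>q\<close>.\<close>

lemma cong_q_power_invert:
  assumes "[x = y * q ^ k] (mod n)"
  shows "[y = x * q ^ (k * (m - 1))] (mod n)"
proof -
  have "k + k * (m - 1) = m * k"
    using m_pos by (cases m) auto
  then have "[y * q ^ k * q ^ (k * (m - 1)) = y * 1] (mod n)"
    using cong_scalar_left[OF q_power_mult[of k], of y] by (simp add: mult.assoc flip: power_add)
  then show ?thesis
    using cong_scalar_right[OF assms, of "q ^ (k * (m - 1))"] by (metis cong_sym cong_trans mult_1_right)
qed

lemma cl_cong_mult:
  assumes "x \<in> cl J" "[y = x * q ^ k] (mod n)" "y < n"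
  shows "y \<in> cl J"
proof -
  obtain i l where i: "i \<in> J" "[x = i * q ^ l] (mod n)"
    using assms(1) by (auto simp: cl_iff)
  have "[y = i * q ^ (l + k)] (mod n)"
    using cong_trans[OF assms(2) cong_scalar_right[OF i(2), of "q ^ k"]]
    by (simp add: power_add mult.assoc)
  then show ?thesis
    using i(1) assms(3) by (auto simp: cl_iff)
qed

lemma cl_mult: "x \<in> cl J \<Longrightarrow> x * q ^ k mod n \<in> cl J"
  by (rule cl_cong_mult[of x J _ k]) (auto simp: n_pos)

lemma cl_of_mult:
  assumes "y < n" "y * q ^ k mod n \<in> cl J"
  shows "y \<in> cl J"
  by (rule cl_cong_mult[OF assms(2) cong_q_power_invert assms(1)]) (simp add: cong_def)

lemma mod_mem_cl: "j \<in> J \<Longrightarrow> j mod n \<in> cl J"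
  using n_pos by (force simp: cl_iff cong_def intro: exI[of _ 0])

lemma cl_idem:
  assumes "A \<subseteq> {..<n}" "\<And>a. a \<in> A \<Longrightarrow> a * q mod n \<in> A"
  shows "cl A = A"
proof
  have "a * q ^ k mod n \<in> A" if "a \<in> A" for a k
  proof (induction k)
    case 0
    then show ?case using that assms(1) by auto
  next
    case (Suc k)
    have "(a * q ^ k mod n) * q mod n = a * q ^ Suc k mod n"
      by (metis mod_mult_left_eq mult.assoc power_Suc2)
    then show ?case using assms(2)[OF Suc] by simp
  qed
  then show "cl A \<subseteq> A" by (auto simp: cyc_closure_def)
  show "A \<subseteq> cl A"
  proof
    fix a assume "a \<in> A"
    with mod_mem_cl[OF this] assms(1) show "a \<in> cl A" by auto
  qed
qed

section \<open>Negation of exponents modulo \<open>n\<close>\<close>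

lemma cong_neg_mult:
  assumes "n dvd a + b"
  shows "n dvd a * c mod n + b * c mod n"
proof -
  have "n dvd (a + b) * c"
    using assms by simp
  then show ?thesis
    by (simp add: add_mult_distrib mod_add_eq dvd_eq_mod_eq_0)
qed

text \<open>\<open>n - 1\<close> stands for -1 in the natural numbers. Applied to the zeros of a
  code, this gives the zeros of its dual.\<close>

definition co_neg :: "nat set \<Rightarrow> nat set" where
  "co_neg T = {j. j < n \<and> (n - 1) * j mod n \<notin> T}"

lemma dvd_pred_mult_add: "n dvd (n - 1) * j + j"
proof -
  have "(n - 1) * j + j = n * j"
    using n_pos by (cases n) auto
  then show ?thesis
    by simp
qed

lemma dvd_add_neg: "n dvd j + (n - 1) * j mod n"
  using dvd_pred_mult_add[of j] by (simp add: dvd_eq_mod_eq_0 mod_add_right_eq add.commute)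

lemma neg_unique:
  fixes a b c :: nat
  assumes "n dvd a + b" "n dvd a + c" "b < n" "c < n"
  shows "b = c"
proof -
  have "[a + b = a + c] (mod n)"
    using assms(1,2) by (simp add: cong_def dvd_eq_mod_eq_0)
  then have "[b = c] (mod n)"
    by (simp add: cong_add_lcancel_nat)
  then show ?thesis
    using assms(3,4) by (simp add: cong_def)
qed

lemma co_neg_iff:
  assumes "j < n" "i < n" "n dvd j + i"
  shows "j \<in> co_neg T \<longleftrightarrow> i \<notin> T"
proof -
  have "(n - 1) * j mod n = i"
    by (rule neg_unique[OF dvd_add_neg assms(3)]) (use assms n_pos in auto)
  then show ?thesis
    using assms(1) by (simp add: co_neg_def)
qed

lemma cl_co_neg: "cl (co_neg (cl J)) = co_neg (cl J)"
proof (rule cl_idem)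
  fix a assume a: "a \<in> co_neg (cl J)"
  let ?b = "(n - 1) * a mod n"
  have b: "?b \<notin> cl J" "?b < n"
    using a n_pos by (auto simp: co_neg_def)
  have "?b * q ^ 1 mod n \<notin> cl J"
    using b cl_of_mult[of ?b 1] by blast
  moreover have "n dvd a * q mod n + ?b * q mod n"
    by (rule cong_neg_mult[OF dvd_add_neg])
  ultimately show "a * q mod n \<in> co_neg (cl J)"
    using n_pos co_neg_iff[of "a * q mod n" "?b * q mod n"] by simp
qed (auto simp: co_neg_def)

end

context cyclotomic
begin

text \<open>The exponents 0 and \<open>-y\<close> lie in \<open>cl {b..c}\<close>, so the interval
  contains a multiple \<open>n * u\<close> and some \<open>i'\<close> congruent to
  \<open>-z\<close>, with \<open>z\<close> in the coset of \<open>y\<close>. If \<open>i'\<close>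
  belongs to a later multiple of \<open>n\<close>, the interval passes a negative of
  \<open>t\<close>; otherwise it passes one of 1 and, when \<open>z\<close> is not 1, one of
  2.\<close>

lemma convex_zeros_obstruction:
  assumes eq: "co_neg (cl J) = cl {b..c}" and "0 < b" and "0 \<notin> cl J" and two: "2 \<in> cl J"
    and y: "0 < y" "y < n" "y \<notin> cl J"
    and t: "t \<in> cl J" "\<And>k. y * q ^ k mod n < t"
    and one: "1 \<in> cl J \<or> (\<forall>k. y * q ^ k mod n \<noteq> 1)"
  shows False
proof -
  have neg: "w \<notin> cl J" if "i \<in> {b..c}" "n dvd i + w" "w < n" for i w
  proof -
    have "i mod n \<in> co_neg (cl J)"
      unfolding eq using that(1) by (rule mod_mem_cl)
    moreover have "n dvd i mod n + w"
      using that(2) by (simp add: dvd_eq_mod_eq_0 mod_add_left_eq)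
    ultimately show ?thesis
      using co_neg_iff[of "i mod n" w] that(3) n_pos by simp
  qed
  have tn: "t < n" using cl_less t(1) by blast
  have "0 \<in> co_neg (cl J)"
    using co_neg_iff[of 0 0] assms(3) n_pos by simp
  then obtain i k where i: "i \<in> {b..c}" "[0 = i * q ^ k] (mod n)"
    unfolding eq cl_iff by blast
  from cong_q_power_invert[OF i(2)] have "n dvd i"
    by (simp add: cong_def dvd_eq_mod_eq_0)
  then obtain u where u: "i = n * u" by blast
  have u_pos: "u > 0" using i(1) u assms(2) by (cases u) auto
  have "n - y \<in> co_neg (cl J)"
    using co_neg_iff[of "n - y" y] y by simp
  then obtain i' k' where i': "i' \<in> {b..c}" "[n - y = i' * q ^ k'] (mod n)"
    unfolding eq cl_iff by blast
  define l where "l = k' * (m - 1)"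
  define z where "z = y * q ^ l mod n"
  have "[i' = (n - y) * q ^ l] (mod n)"
    unfolding l_def by (rule cong_q_power_invert[OF i'(2)])
  then have "[i' + z = (n - y) * q ^ l + y * q ^ l] (mod n)"
    unfolding z_def by (intro cong_add) auto
  also have "(n - y) * q ^ l + y * q ^ l = n * q ^ l"
    using y(2) by (simp flip: add_mult_distrib)
  finally have "n dvd i' + z"
    by (simp add: cong_def dvd_eq_mod_eq_0)
  then obtain u' where u': "i' + z = n * u'" by blast
  have z_pos: "z > 0"
  proof (rule ccontr)
    assume "\<not> z > 0"
    then have "[0 = y * q ^ l] (mod n)" by (simp add: z_def cong_def)
    from cong_q_power_invert[OF this] show False
      using y(1,2) by (simp add: cong_def)
  qed
  have zt: "z < t" unfolding z_def by (rule t(2))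
  show False
  proof (cases "u < u'")
    case True
    then have "n * u + n \<le> n * u'"
      using mult_le_mono2[of "Suc u" u' n] by simp
    \<comment> \<open>\<open>i'\<close> is at least \<open>n * u + n - z\<close>, and
      \<open>z < t\<close>, so this point lies between \<open>n * u\<close> and
      \<open>i'\<close>.\<close>
    then have "n * u + n - t \<in> {b..c}"
      using i(1) i'(1) u u' zt tn by auto
    then show False
      using neg[of "n * u + n - t" t] tn t(1) by simp
  next
    case False
    then have le: "i' + z \<le> n * u" using u' by simp
    have nu: "n \<le> n * u" using u_pos by simp
    have nu_c: "n * u \<le> c" using i(1) u by simp
    have "n * u - 1 \<in> {b..c}"
      using i'(1) nu_c z_pos le by auto
    then have "1 \<notin> cl J"
      using neg[of "n * u - 1" 1] nu zt tn z_pos by simp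
    \<comment> \<open>Since 1 has just been excluded from \<open>cl J\<close>, \<open>one\<close>
      says that the coset of \<open>y\<close> avoids 1.\<close>
    then have "z \<noteq> 1"
      using one unfolding z_def by blast
    then have z2: "z \<ge> 2" using z_pos by simp
    then have mem: "n * u - 2 \<in> {b..c}"
      using i'(1) nu_c le by auto
    have "n * u - 2 + 2 = n * u"
      using nu zt tn z2 by linarith
    then have "n dvd n * u - 2 + 2"
      by (simp only: dvd_triv_left)
    from neg[OF mem this] show False
      using zt tn z2 two by auto
  qed
qed

lemma cl_interval_obtain:
  assumes "x \<in> cl {a..d}" "d < n"
  obtains k where "x * q ^ k mod n \<in> {a..d}"
proof -
  obtain i k where i: "i \<in> {a..d}" "[x = i * q ^ k] (mod n)"
    using assms(1) by (auto simp: cl_iff)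
  have "i mod n = x * q ^ (k * (m - 1)) mod n"
    using cong_q_power_invert[OF i(2)] by (simp add: cong_def)
  then show ?thesis
    using that i(1) assms(2) by (metis atLeastAtMost_iff mod_less order_le_less_trans)
qed

end

subsection \<open>Extremal cyclotomic cosets\<close>

lemma repunit_exists:
  assumes "(q::nat) > 0"
  shows "\<exists>u. (q - 1) * u + 1 = q ^ l"
proof (induction l)
  case (Suc l)
  then obtain u where u: "(q - 1) * u + 1 = q ^ l" by blast
  have "(q - 1) * (u * q + 1) + 1 = ((q - 1) * u + 1) * q"
    using assms by (cases q) (auto simp: algebra_simps)
  with u show ?case by (metis power_Suc2)
qed simp

locale bch_length =
  fixes q m n :: nat
  assumes q_ge: "q \<ge> 3" and m_ge: "m \<ge> 4" and n_eq: "n * (q - 1) + 1 = q ^ m"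

sublocale bch_length \<subseteq> cyclotomic q m n
proof
  show "n > 0"
    using n_eq q_ge m_ge power_gt1[of q "m - 1"] by (cases n) auto
  show "m > 0" using m_ge by simp
  show "[q ^ m = 1] (mod n)"
    unfolding n_eq[symmetric] cong_def by (metis mod_mult_self2 add.commute)
qed

context bch_length
begin

lemma mult_q_power_m: "[x * q ^ (i + m) = x * q ^ i] (mod n)"
  using cong_scalar_left[OF q_power, of "x * q ^ i"] by (simp add: power_add mult.assoc)

definition digit :: "nat \<Rightarrow> nat \<Rightarrow> nat" where
  "digit j i = q * (j * q ^ i mod n) div n"

text \<open>Long division of \<open>j\<close> by \<open>n\<close> in base \<open>q\<close>: the
  residue is the current remainder, the digits read so far form the quotient.\<close>

lemma horner_digit:
  assumes "j < n"
  shows "j * q ^ r = j * q ^ r mod n + n * horner q (digit j) r"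
proof (induction r)
  case (Suc r)
  define x where "x = j * q ^ r mod n"
  have x: "j * q ^ r = x + n * horner q (digit j) r"
    using Suc by (simp add: x_def)
  have "j * q ^ Suc r = q * (j * q ^ r)"
    by simp
  also have "\<dots> = q * x + n * (q * horner q (digit j) r)"
    unfolding x by (simp add: algebra_simps)
  also have "q * x = q * x mod n + n * digit j r"
    unfolding digit_def x_def by (rule mod_mult_div_eq[symmetric])
  also have "q * x mod n = j * q ^ Suc r mod n"
    unfolding x_def by (simp add: mod_mult_right_eq ac_simps)
  finally show ?case by (simp add: algebra_simps)
qed (use assms in simp)

text \<open>After \<open>m\<close> digits the remainder is \<open>j\<close> again, so the quotient
  is \<open>j * (q ^ m - 1) / n\<close>.\<close>

lemma horner_digit_full:
  assumes "j < n"
  shows "horner q (digit j) m = (q - 1) * j"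
proof -
  have "j * q ^ m mod n = j"
    using mult_q_power_m[of j 0] assms by (simp add: cong_def)
  then have "j * (n * (q - 1) + 1) = j + n * horner q (digit j) m"
    unfolding n_eq using horner_digit[OF assms, of m] by simp
  moreover have "j * (n * (q - 1) + 1) = j + n * ((q - 1) * j)"
    by (simp add: distrib_left ac_simps)
  ultimately have "n * (horner q (digit j) m) = n * ((q - 1) * j)"
    by linarith
  then show ?thesis using n_pos by simp
qed

lemma digit_shift: "digit (j * q ^ k mod n) i = digit j (k + i)"
  by (simp add: digit_def mod_mult_left_eq power_add mult.assoc)

lemma digit_periodic: "digit j (i + m) = digit j i"
  using mult_q_power_m[of j i] by (simp add: digit_def cong_def)

text \<open>
  The balanced word of weight \<open>c (q - 1)\<close>: its prefix of length \<open>r\<close> has digit sum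
  \<open>\<lceil>r c (q - 1) / m\<rceil>\<close>.
\<close>

definition balanced :: "nat \<Rightarrow> nat \<Rightarrow> nat" where
  "balanced c r = cdiv m (Suc r * (c * (q - 1))) - cdiv m (r * (c * (q - 1)))"

lemma sum_balanced:
  "(\<Sum>i<r. balanced c (k + i)) = cdiv m ((k + r) * (c * (q - 1))) - cdiv m (k * (c * (q - 1)))"
proof (induction r)
  case (Suc r)
  have "cdiv m (k * (c * (q - 1))) \<le> cdiv m ((k + r) * (c * (q - 1)))"
    "cdiv m ((k + r) * (c * (q - 1))) \<le> cdiv m (Suc (k + r) * (c * (q - 1)))"
    by (intro cdiv_mono mult_le_mono1; simp)+
  then show ?case using Suc by (simp add: balanced_def)
qed simp

lemma sum_balanced_0: "(\<Sum>i<r. balanced c i) = cdiv m (r * (c * (q - 1)))"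
proof -
  have "cdiv m 0 = 0" using m_pos by (simp add: cdiv_def)
  then show ?thesis using sum_balanced[of c 0 r] by simp
qed

text \<open>By subadditivity of the ceiling no factor of the word is heavier than the prefix of the
  same length; hence no rotation exceeds the word itself.\<close>

lemma sum_balanced_le: "(\<Sum>i<r. balanced c (k + i)) \<le> cdiv m (r * (c * (q - 1)))"
  unfolding sum_balanced add_mult_distrib
  using cdiv_add_le[OF m_pos, of "k * (c * (q - 1))" "r * (c * (q - 1))"] by linarith

lemma sum_balanced_ge: "r * (c * (q - 1)) div m \<le> (\<Sum>i<r. balanced c (k + i))"
  unfolding sum_balanced add_mult_distrib
  using le_cdiv_add[OF m_pos, of "k * (c * (q - 1))" "r * (c * (q - 1))"] by linarith

lemma balanced_periodic: "balanced c (i + m) = balanced c i"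
proof -
  have "cdiv m ((i + m) * (c * (q - 1))) = cdiv m (i * (c * (q - 1))) + c * (q - 1)" for i
    using cdiv_add_mult[OF m_pos, of "i * (c * (q - 1))" "c * (q - 1)"]
    by (simp only: add_mult_distrib mult.commute[of m])
  from this[of i] this[of "Suc i"] show ?thesis by (simp add: balanced_def)
qed

lemma sum_balanced_full: "(\<Sum>i<m. balanced c i) = c * (q - 1)"
proof -
  have "cdiv m 0 = 0" using m_pos by (simp add: cdiv_def)
  then have "cdiv m (0 + c * (q - 1) * m) = c * (q - 1)"
    by (simp only: cdiv_add_mult[OF m_pos])
  then show ?thesis unfolding sum_balanced_0 by (simp add: ac_simps)
qed

text \<open>A digit is at most the ceiling of \<open>2 * (q - 1) / m\<close>. With
  \<open>m \<ge> 4\<close> it suffices that \<open>2 * (q - 1) \<le> 4 * (q - 2)\<close>, which is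
  \<open>q \<ge> 3\<close>.\<close>

lemma balanced_le:
  assumes "c \<le> 2"
  shows "balanced c i \<le> q - 2"
proof -
  obtain a where a: "q = a + 3" using q_ge le_Suc_ex by (metis add.commute)
  have "c * (q - 1) \<le> 2 * (q - 1)"
    using assms by simp
  also have "\<dots> \<le> (q - 2) * 4"
    using a by simp
  also have "\<dots> \<le> (q - 2) * m"
    using m_ge by simp
  finally have "cdiv m (c * (q - 1)) \<le> q - 2"
    by (simp add: cdiv_le_iff[OF m_pos])
  then show ?thesis
    using sum_balanced_le[where r = 1 and c = c and k = i] by simp
qed

text \<open>Converse of the digit expansion. Rotating a word multiplies its value by
  \<open>q\<close> modulo \<open>q ^ m - 1\<close>, which after division by \<open>q - 1\<close> is
  multiplication of the exponent by \<open>q\<close> modulo \<open>n\<close>.\<close>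

lemma word_coset:
  assumes per: "\<And>i. e (i + m) = e i" and le: "\<And>i. e i \<le> q - 2"
    and sum: "q - 1 dvd (\<Sum>i<m. e i)"
  shows "\<exists>y<n. \<forall>k. (q - 1) * (y * q ^ k mod n) = horner q (\<lambda>i. e (k + i)) m"
proof -
  define X where "X = (\<lambda>k. horner q (\<lambda>i. e (k + i)) m)"
  \<comment> \<open>The word of length \<open>m + 1\<close> is evaluated twice, splitting off its
    last digit and its first; by periodicity both are \<open>e k\<close>.\<close>
  have step: "q * X k + e k = e k * (n * (q - 1) + 1) + X (Suc k)" for k
    unfolding n_eq X_def using horner_shift[of q "\<lambda>i. e (k + i)" m] per[of k] by simp
  \<comment> \<open>The digit bound keeps every value below \<open>q ^ m - 1\<close>, so its
    quotient by \<open>q - 1\<close> is a reduced residue.\<close>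
  have lt: "X k < (q - 1) * n" for k
  proof -
    have "X k * (q - 1) + (q - 2) \<le> (q - 2) * (n * (q - 1) + 1)"
      unfolding X_def n_eq using q_ge le by (intro horner_le) auto
    then have "X k * (q - 1) \<le> ((q - 2) * n) * (q - 1)"
      by (simp add: algebra_simps)
    then have "X k \<le> (q - 2) * n"
      using q_ge by simp
    also have "\<dots> < (q - 1) * n"
      using q_ge n_pos by simp
    finally show ?thesis .
  qed
  have "q - 1 dvd X 0"
    using sum q_ge dvd_horner_iff[of q e m] by (simp add: X_def)
  then obtain y where y: "X 0 = (q - 1) * y" by blast
  have yn: "y < n" using lt[of 0] y by simp
  have "(q - 1) * (y * q ^ k mod n) = X k" for k
  proof (induction k)
    case 0
    then show ?case using y yn by simp
  next
    case (Suc k)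
    define z where "z = y * q ^ k mod n"
    have z: "X k = (q - 1) * z" using Suc by (simp add: z_def)
    have 1: "(q - 1) * (q * z) = (q - 1) * (n * e k) + X (Suc k)"
      using step[of k] unfolding z by (simp add: algebra_simps)
    then have "q - 1 dvd X (Suc k)"
      by (metis dvd_add_right_iff dvd_triv_left)
    then obtain z' where z': "X (Suc k) = (q - 1) * z'" by blast
    have "(q - 1) * (q * z) = (q - 1) * (n * e k + z')"
      using 1 by (simp only: z' add_mult_distrib2)
    then have "q * z = n * e k + z'" using q_ge by simp
    moreover have "z' < n" using lt[of "Suc k"] z' by simp
    ultimately have "q * z mod n = z'" by simp
    moreover have "q * z mod n = y * q ^ Suc k mod n"
      unfolding z_def by (simp add: mod_mult_right_eq ac_simps)
    ultimately show ?case using z' by simp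
  qed
  with yn show ?thesis unfolding X_def by blast
qed

lemma balanced_coset:
  assumes "c \<le> 2"
  shows "\<exists>y<n. \<forall>k. (q - 1) * (y * q ^ k mod n) = horner q (\<lambda>i. balanced c (k + i)) m"
  by (rule word_coset) (auto simp: balanced_periodic sum_balanced_full balanced_le assms)

lemma horner_balanced_le:
  assumes "c \<le> 2"
  shows "horner q (\<lambda>i. balanced c (k + i)) m \<le> (q - 2) * n"
proof -
  have "horner q (\<lambda>i. balanced c (k + i)) m * (q - 1) + (q - 2) \<le> (q - 2) * (n * (q - 1) + 1)"
    unfolding n_eq using q_ge balanced_le[OF assms] by (intro horner_le) auto
  then have "horner q (\<lambda>i. balanced c (k + i)) m * (q - 1) \<le> ((q - 2) * n) * (q - 1)"
    by (simp add: algebra_simps)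
  then show ?thesis using q_ge by simp
qed

text \<open>The condition forces digit sum at least 1 on the first \<open>m - d\<close> places of
  every rotation, hence a nonzero digit of weight at least \<open>q ^ d\<close>.\<close>

lemma horner_balanced_ge:
  assumes "d \<le> m" "m \<le> (m - d) * (c * (q - 1))"
  shows "q ^ d \<le> horner q (\<lambda>i. balanced c (k + i)) m"
proof -
  have "1 \<le> (m - d) * (c * (q - 1)) div m"
    using assms(2) m_pos by (simp add: Suc_le_eq div_greater_zero_iff)
  also have "\<dots> \<le> (\<Sum>i<m - d. balanced c (k + i))"
    by (rule sum_balanced_ge)
  finally have "1 * q ^ d \<le> (\<Sum>i<m - d. balanced c (k + i)) * q ^ d"
    by (rule mult_le_mono1)
  also have "\<dots> \<le> horner q (\<lambda>i. balanced c (k + i)) (m - d + d)"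
    using q_ge by (intro sum_mult_power_le_horner) simp
  finally show ?thesis using assms(1) by simp
qed

section \<open>The smallest maximum of a nonzero coset\<close>

definition nu :: nat where
  "nu = horner q (balanced 1) m div (q - 1)"

lemma nu_less: "nu < n"
  and nu_rotate: "(q - 1) * (nu * q ^ k mod n) = horner q (\<lambda>i. balanced 1 (k + i)) m"
proof -
  obtain y where y: "y < n"
      "\<And>k. (q - 1) * (y * q ^ k mod n) = horner q (\<lambda>i. balanced 1 (k + i)) m"
    using balanced_coset[of 1] by auto
  have "(q - 1) * y = horner q (balanced 1) m"
    using y(2)[of 0] y(1) by simp
  then have "nu = (q - 1) * y div (q - 1)"
    by (simp only: nu_def)
  then have "y = nu"
    using q_ge by simp
  with y show "nu < n" "(q - 1) * (nu * q ^ k mod n) = horner q (\<lambda>i. balanced 1 (k + i)) m"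
    by auto
qed

lemma horner_balanced_1: "horner q (balanced 1) m = (q - 1) * nu"
  using nu_rotate[of 0] nu_less by simp

lemma nu_rotate_le: "nu * q ^ k mod n \<le> nu"
proof -
  have "horner q (\<lambda>i. balanced 1 (k + i)) m \<le> horner q (balanced 1) m"
  proof (rule horner_mono_prefix)
    fix r
    show "(\<Sum>i<r. balanced 1 (k + i)) \<le> (\<Sum>i<r. balanced 1 i)"
      using sum_balanced_le[of 1 k r] by (simp only: sum_balanced_0)
  qed (use q_ge in simp)
  then show ?thesis
    unfolding nu_rotate[symmetric] horner_balanced_1 using q_ge by simp
qed

lemma nu_rotate_ge: "q ^ (m div 2) \<le> (q - 1) * (nu * q ^ k mod n)"
  unfolding nu_rotate
proof (rule horner_balanced_ge)
  have "m \<le> (m - m div 2) * 2" by simp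
  also have "\<dots> \<le> (m - m div 2) * (1 * (q - 1))"
    using q_ge by (intro mult_le_mono2) simp
  finally show "m \<le> (m - m div 2) * (1 * (q - 1))" .
qed simp

text \<open>The digit sum is a nonzero multiple of \<open>q - 1\<close>. The rotation from
  \<open>cycle_lemma\<close> therefore has prefix sums at least \<open>r * (q - 1) / m\<close>;
  being integers, they reach the ceiling, which is the prefix sum of the balanced word.\<close>

lemma exists_rotate_ge_nu:
  assumes "0 < j" "j < n"
  shows "\<exists>k. nu \<le> j * q ^ k mod n"
proof -
  define S where "S = (\<Sum>i<m. digit j i)"
  have "q - 1 dvd S"
    using dvd_horner_iff[of q "digit j" m] horner_digit_full[OF assms(2)] q_ge
    by (simp add: S_def)
  moreover have "S \<noteq> 0"
  proof
    assume "S = 0"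
    then have "horner q (digit j) m = 0"
      by (simp add: S_def horner_sum)
    then show False
      using horner_digit_full[OF assms(2)] assms(1) q_ge by simp
  qed
  ultimately have S: "q - 1 \<le> S"
    by (intro dvd_imp_le) auto
  obtain k where k: "\<And>r. r \<le> m \<Longrightarrow> r * S \<le> m * (\<Sum>i<r. digit j (k + i))"
    using cycle_lemma[of m "digit j"] m_pos digit_periodic unfolding S_def by blast
  have "horner q (balanced 1) m \<le> horner q (\<lambda>i. digit j (k + i)) m"
  proof (rule horner_mono_prefix)
    fix r assume "r \<le> m"
    have "r * (1 * (q - 1)) \<le> r * S"
      using S by simp
    also have "\<dots> \<le> (\<Sum>i<r. digit j (k + i)) * m"
      using k[OF \<open>r \<le> m\<close>] by (simp add: mult.commute)
    finally show "(\<Sum>i<r. balanced 1 i) \<le> (\<Sum>i<r. digit j (k + i))"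
      unfolding sum_balanced_0 by (simp only: cdiv_le_iff[OF m_pos])
  qed (use q_ge in simp)
  also have "(\<lambda>i. digit j (k + i)) = digit (j * q ^ k mod n)"
    by (rule ext) (simp add: digit_shift)
  also have "horner q (digit (j * q ^ k mod n)) m = (q - 1) * (j * q ^ k mod n)"
    using n_pos by (intro horner_digit_full) simp
  finally have "nu \<le> j * q ^ k mod n"
    unfolding horner_balanced_1 using q_ge by simp
  then show ?thesis by blast
qed

lemma power_less_n: "q ^ (m - 1) < n"
proof -
  have "q ^ (m - 1) > 1"
    using q_ge m_ge by (intro one_less_power) auto
  moreover have "q ^ m = q ^ (m - 1) * (q - 1) + q ^ (m - 1)"
    using m_ge q_ge by (cases m; cases q) auto
  ultimately have "q ^ (m - 1) * (q - 1) < n * (q - 1)"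
    using n_eq by linarith
  then show ?thesis by simp
qed

text \<open>Taken from the balanced word of weight \<open>2 * (q - 1)\<close>: every rotation has a
  nonzero digit in its first \<open>m div 2\<close> places, and digits at most \<open>q - 2\<close>
  give the upper bound.\<close>

lemma middle_coset:
  "\<exists>y<n. \<forall>k. q ^ (m - m div 2) \<le> (q - 1) * (y * q ^ k mod n) \<and> y * q ^ k mod n < q ^ (m - 1)"
proof -
  obtain y where y: "y < n"
      "\<And>k. (q - 1) * (y * q ^ k mod n) = horner q (\<lambda>i. balanced 2 (k + i)) m"
    using balanced_coset[of 2] by auto
  have "q ^ (m - m div 2) \<le> (q - 1) * (y * q ^ k mod n)" for k
    unfolding y(2)
  proof (rule horner_balanced_ge)
    have "m \<le> m div 2 * 4" using m_ge by linarith
    also have "\<dots> \<le> m div 2 * (2 * (q - 1))"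
      using q_ge by (intro mult_le_mono2) simp
    finally show "m \<le> (m - (m - m div 2)) * (2 * (q - 1))" by simp
  qed simp
  moreover have "y * q ^ k mod n < q ^ (m - 1)" for k
  proof -
    define z where "z = y * q ^ k mod n"
    have 1: "(q - 1) * z \<le> (q - 2) * n"
      unfolding z_def y(2) by (rule horner_balanced_le) simp
    obtain a where a: "q = a + 3" using q_ge le_Suc_ex by (metis add.commute)
    have "(q - 1) * (q * z) \<le> q * ((q - 2) * n)"
      using mult_le_mono2[OF 1, of q] by (simp add: ac_simps)
    \<comment> \<open>\<open>q * (q - 2)\<close> is one less than the square of
      \<open>q - 1\<close>.\<close>
    also have "\<dots> < (q - 1) * (n * (q - 1) + 1)"
      by (simp add: a algebra_simps)
    also have "\<dots> = (q - 1) * (q * q ^ (m - 1))"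
      unfolding n_eq using m_ge by (cases m) auto
    finally show ?thesis using q_ge by (simp add: z_def)
  qed
  ultimately show ?thesis using y(1) by blast
qed

text \<open>A rotation of \<open>-x\<close> that reaches \<open>nu\<close> yields a rotation
  \<open>z\<close> of \<open>x\<close> with \<open>z \<le> n - nu \<le> \<delta>\<close>. As the
  interval starts at 2, the case \<open>z = 1\<close> passes on to the rotation
  \<open>q\<close>.\<close>

lemma closure_nonzero:
  assumes "n \<le> \<delta> + nu" "\<delta> < n" "0 < x" "x < n"
  shows "x \<in> cl {2..\<delta>}"
proof -
  obtain k where k: "nu \<le> (n - x) * q ^ k mod n"
    using exists_rotate_ge_nu[of "n - x"] assms by auto
  define z where "z = x * q ^ k mod n"
  have dvd: "n dvd z + (n - x) * q ^ k mod n"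
    unfolding z_def using assms by (intro cong_neg_mult) simp
  have zn: "z < n" unfolding z_def using n_pos by simp
  have z0: "z \<noteq> 0"
  proof
    assume "z = 0"
    then have "[0 = x * q ^ k] (mod n)" by (simp add: z_def cong_def)
    from cong_q_power_invert[OF this] show False
      using assms by (simp add: cong_def)
  qed
  have "z \<le> n - nu"
  proof -
    have "z + (n - x) * q ^ k mod n < 2 * n"
      using zn n_pos by (simp add: add_less_mono mult_2)
    moreover obtain w where w: "z + (n - x) * q ^ k mod n = n * w"
      using dvd by blast
    ultimately have "w < 2" by (simp add: mult.commute[of 2])
    moreover have "w \<noteq> 0" using w z0 by (cases "w = 0") auto
    ultimately have "w = 1" by linarith
    with w have "z + (n - x) * q ^ k mod n = n" by simp
    then show ?thesis using k by linarith
  qed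
  then have z\<delta>: "z \<le> \<delta>" using assms(1) by linarith
  show ?thesis
  proof (cases "z = 1")
    case False
    then have "z \<in> {2..\<delta>}" using z0 z\<delta> by auto
    from mod_mem_cl[OF this] have "x * q ^ k mod n \<in> cl {2..\<delta>}"
      using zn by (simp add: z_def)
    then show ?thesis using cl_of_mult assms(4) by blast
  next
    case True
    \<comment> \<open>In fact \<open>q \<le> n - nu\<close>, since \<open>nu\<close> is at most
      \<open>(q - 2) * n / (q - 1)\<close> and \<open>n\<close> is at least
      \<open>q * (q - 1)\<close>.\<close>
    have "q \<le> \<delta>"
    proof -
      have "q * (q - 1) \<le> q * q" by simp
      also have "\<dots> \<le> q ^ (m - 1)"
        using m_ge q_ge power_increasing[of 2 "m - 1" q] by (simp add: power2_eq_square)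
      also have "\<dots> \<le> n" using power_less_n by simp
      finally have 1: "q * (q - 1) \<le> n" .
      have "(q - 1) * nu \<le> (q - 2) * n"
        using horner_balanced_le[of 1 0] unfolding add_0 horner_balanced_1 by simp
      moreover have "(q - 2) * n + n = (q - 1) * n"
        using q_ge by (cases q; cases "q - 1") auto
      ultimately have "(q - 1) * (nu + q) \<le> (q - 1) * n"
        using 1 by (simp add: distrib_left mult.commute[of q])
      then show ?thesis using q_ge assms(1) by simp
    qed
    then have "q \<in> {2..\<delta>}" using q_ge by simp
    from mod_mem_cl[OF this] have "q \<in> cl {2..\<delta>}"
      using \<open>q \<le> \<delta>\<close> assms(2) by simp
    moreover have "x * q ^ Suc k mod n = q"
    proof -
      have "x * q ^ Suc k mod n = z * q mod n"
        unfolding z_def by (metis mod_mult_left_eq mult.assoc power_Suc2)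
      then show ?thesis using True \<open>q \<le> \<delta>\<close> assms(2) by simp
    qed
    ultimately show ?thesis using cl_of_mult[of x "Suc k"] assms(4) by simp
  qed
qed

lemma zero_not_mem_closure:
  assumes "\<delta> < n"
  shows "0 \<notin> cl {2..\<delta>}"
proof
  assume "0 \<in> cl {2..\<delta>}"
  then obtain k where "0 * q ^ k mod n \<in> {2..\<delta>}"
    using cl_interval_obtain assms by blast
  then show False by simp
qed

lemma one_mem_closure:
  assumes "q \<le> \<delta>"
  shows "1 \<in> cl {2..\<delta>}"
proof -
  have "q mod n \<in> cl {2..\<delta>}"
    using assms q_ge by (intro mod_mem_cl) simp
  moreover have "1 < n"
    using power_less_n q_ge one_le_power[of q "m - 1"] by linarith
  ultimately show ?thesis
    using cl_of_mult[of 1 1] by simp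
qed

text \<open>In base \<open>q\<close> the number \<open>n\<close> is a string of \<open>m\<close>
  ones, cut here into its first \<open>l\<close> and its last \<open>d\<close> ones.\<close>

lemma repunit_split:
  assumes "l + d = m" "(q - 1) * u + 1 = q ^ l" "(q - 1) * v + 1 = q ^ d"
  shows "n = u * q ^ d + v"
proof -
  have "(q - 1) * (u * q ^ d + v) + 1 = (q - 1) * u * q ^ d + ((q - 1) * v + 1)"
    by (simp add: distrib_left)
  also have "\<dots> = ((q - 1) * u + 1) * q ^ d"
    by (simp only: assms(3) add_mult_distrib mult_1)
  also have "\<dots> = q ^ m"
    by (simp only: assms(2) assms(1) flip: power_add)
  also have "\<dots> = n * (q - 1) + 1"
    by (rule n_eq[symmetric])
  finally have "(q - 1) * (u * q ^ d + v) = (q - 1) * n"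
    by (simp add: mult.commute)
  then show ?thesis using q_ge by simp
qed

text \<open>Each of three ranges of \<open>\<delta>\<close> supplies a missed \<open>y\<close> and a
  larger zero \<open>t\<close> for \<open>convex_zeros_obstruction\<close>: \<open>nu\<close> and a
  rotation of 2; a middle coset and \<open>q ^ (m - 1)\<close>; \<open>n - nu\<close> and
  \<open>n - v\<close>. Here \<open>u\<close> and \<open>v\<close> are the strings of
  \<open>m - m div 2\<close> and \<open>m div 2\<close> ones.\<close>

lemma not_convex_zeros:
  assumes eq: "co_neg (cl {2..\<delta>}) = cl {b..c}" and "0 < b" "2 \<le> \<delta>" "\<delta> + nu < n"
  shows False
proof -
  have \<delta>n: "\<delta> < n" using assms(4) by simp
  have zero: "0 \<notin> cl {2..\<delta>}"
    using \<delta>n by (rule zero_not_mem_closure)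
  have two: "2 \<in> cl {2..\<delta>}"
    using mod_mem_cl[of 2 "{2..\<delta>}"] assms(3) \<delta>n by simp
  note obstruction = convex_zeros_obstruction[OF eq assms(2) zero two]
  have m2: "2 \<le> m div 2" using m_ge by linarith
  have nu_gt: "q < nu * q ^ k mod n" for k
  proof -
    have "(q - 1) * q < q ^ 2" using q_ge by (simp add: power2_eq_square)
    also have "\<dots> \<le> q ^ (m div 2)" using m2 q_ge by (intro power_increasing) auto
    also have "\<dots> \<le> (q - 1) * (nu * q ^ k mod n)" by (rule nu_rotate_ge)
    finally show ?thesis by simp
  qed
  have nu_pos: "nu > 0" using nu_gt[of 0] by (cases "nu = 0") auto
  obtain u where u: "(q - 1) * u + 1 = q ^ (m - m div 2)" using repunit_exists[of q] q_ge by auto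
  obtain v where v: "(q - 1) * v + 1 = q ^ (m div 2)" using repunit_exists[of q] q_ge by auto
  have n_split: "n = u * q ^ (m div 2) + v"
    using u v by (intro repunit_split) auto
  have q_u: "q < u"
  proof -
    have "q ^ 2 \<le> q ^ (m - m div 2)" using m2 q_ge by (intro power_increasing) auto
    moreover have "(q - 1) * q + 1 < q ^ 2" using q_ge by (cases q) (auto simp: power2_eq_square)
    ultimately have "(q - 1) * q < (q - 1) * u" using u by linarith
    then show ?thesis by simp
  qed
  consider "\<delta> < q" | "q \<le> \<delta>" "\<delta> < u" | "u \<le> \<delta>" by linarith
  then show False
  proof cases
    case 1
    have nu_notin: "nu \<notin> cl {2..\<delta>}"
    proof
      assume "nu \<in> cl {2..\<delta>}"
      then obtain k where "nu * q ^ k mod n \<in> {2..\<delta>}"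
        using cl_interval_obtain \<delta>n by blast
      then show False using nu_gt[of k] 1 by simp
    qed
    obtain k where k: "nu \<le> 2 * q ^ k mod n"
      using exists_rotate_ge_nu[of 2] assms(3) \<delta>n by auto
    have t: "2 * q ^ k mod n \<in> cl {2..\<delta>}" using two by (rule cl_mult)
    have "nu * q ^ i mod n < 2 * q ^ k mod n" for i
    proof -
      have "nu \<noteq> 2 * q ^ k mod n" using t nu_notin by metis
      then show ?thesis using k nu_rotate_le[of i] by linarith
    qed
    moreover have "nu * q ^ i mod n \<noteq> 1" for i
      using nu_gt[of i] q_ge by simp
    ultimately show False
      using obstruction[OF nu_pos nu_less nu_notin t] by blast
  next
    case 2
    obtain y where y: "y < n" "\<And>k. q ^ (m - m div 2) \<le> (q - 1) * (y * q ^ k mod n)"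
        "\<And>k. y * q ^ k mod n < q ^ (m - 1)"
      using middle_coset by blast
    have gt: "u < y * q ^ k mod n" for k
    proof -
      have "(q - 1) * u < (q - 1) * (y * q ^ k mod n)"
        using y(2)[of k] u by linarith
      then show ?thesis by simp
    qed
    have y_notin: "y \<notin> cl {2..\<delta>}"
    proof
      assume "y \<in> cl {2..\<delta>}"
      then obtain k where "y * q ^ k mod n \<in> {2..\<delta>}"
        using cl_interval_obtain \<delta>n by blast
      then show False using gt[of k] 2 by simp
    qed
    have y_pos: "y > 0" using gt[of 0] by (cases "y = 0") auto
    have one: "1 \<in> cl {2..\<delta>}" using 2 by (intro one_mem_closure)
    from cl_mult[OF this, of "m - 1"] have "q ^ (m - 1) \<in> cl {2..\<delta>}"
      using power_less_n by simp
    then show False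
      using obstruction[OF y_pos y(1) y_notin _ y(3)] one by blast
  next
    case 3
    have one: "1 \<in> cl {2..\<delta>}" using 3 q_u by (intro one_mem_closure) simp
    define y where "y = n - nu"
    have y: "0 < y" "y < n" "n dvd y + nu"
      using nu_less nu_pos by (auto simp: y_def)
    have rot: "y * q ^ k mod n = n - nu * q ^ k mod n" for k
    proof (rule neg_unique)
      show "n dvd nu * q ^ k mod n + y * q ^ k mod n"
        using cong_neg_mult[OF y(3)] by (simp add: add.commute)
      show "n dvd nu * q ^ k mod n + (n - nu * q ^ k mod n)"
        using n_pos by simp
      show "n - nu * q ^ k mod n < n" using nu_gt[of k] n_pos by linarith
    qed (use n_pos in simp)
    have y_notin: "y \<notin> cl {2..\<delta>}"
    proof
      assume "y \<in> cl {2..\<delta>}"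
      then obtain k where "y * q ^ k mod n \<in> {2..\<delta>}"
        using cl_interval_obtain \<delta>n by blast
      then have "y * q ^ k mod n \<le> \<delta>" by simp
      then show False using rot[of k] nu_rotate_le[of k] assms(4) by linarith
    qed
    have v_pos: "v > 0"
    proof (rule ccontr)
      assume "\<not> v > 0"
      then have "q ^ (m div 2) = 1" using v by simp
      then show False using q_ge m2 by simp
    qed
    have "u mod n \<in> cl {2..\<delta>}"
      using 3 q_u q_ge by (intro mod_mem_cl) simp
    then have "u \<in> cl {2..\<delta>}" using 3 \<delta>n by simp
    \<comment> \<open>Shifting the leading ones \<open>u\<close> of \<open>n\<close> back into place
      leaves \<open>n\<close> without its trailing ones \<open>v\<close>.\<close>
    from cl_mult[OF this, of "m div 2"] have t: "n - v \<in> cl {2..\<delta>}"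
      using n_split v_pos by simp
    have "y * q ^ k mod n < n - v" for k
    proof -
      have "(q - 1) * v < (q - 1) * (nu * q ^ k mod n)"
        using nu_rotate_ge[of k] v by linarith
      then have "v < nu * q ^ k mod n" by simp
      moreover have "nu * q ^ k mod n < n" using n_pos by simp
      ultimately show ?thesis unfolding rot by linarith
    qed
    then show False
      using obstruction[OF y(1,2) y_notin t] one by blast
  qed
qed

lemma co_neg_convex_iff:
  assumes "2 \<le> \<delta>" "\<delta> \<le> n"
  shows "(\<exists>\<delta>' b'. 2 \<le> \<delta>' \<and> \<delta>' \<le> n \<and> 1 \<le> b' \<and>
      co_neg (cl {2..\<delta>}) = cl {b'..b' + \<delta>' - 2}) \<longleftrightarrow> n \<le> \<delta> + nu \<and> \<delta> \<le> n - 1"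
    (is "?L \<longleftrightarrow> ?R")
proof
  assume ?L
  then obtain \<delta>' b' where *: "2 \<le> \<delta>'" "1 \<le> b'"
      "co_neg (cl {2..\<delta>}) = cl {b'..b' + \<delta>' - 2}" by blast
  have "\<delta> \<noteq> n"
  proof
    assume "\<delta> = n"
    \<comment> \<open>For \<open>\<delta> = n\<close> the exponent \<open>n\<close> stands for 0, so
      every exponent is a zero and the dual has none; but the closure of a nonempty interval is
      nonempty.\<close>
    have "b' mod n \<in> co_neg (cl {2..\<delta>})"
      unfolding *(3) using *(1) by (intro mod_mem_cl) auto
    then have "(n - 1) * (b' mod n) mod n \<notin> cl {2..\<delta>}"
      by (simp add: co_neg_def)
    moreover have "x \<in> cl {2..\<delta>}" if "x < n" for x
    proof -
      have "q ^ 1 \<le> q ^ (m - 1)" using q_ge m_ge by (intro power_increasing) auto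
      then have "1 \<in> cl {2..\<delta>}"
        using power_less_n \<open>\<delta> = n\<close> by (intro one_mem_closure) simp
      moreover have "x \<in> cl {2..\<delta>}" if "x \<in> {2..\<delta>}"
        using mod_mem_cl[OF that] \<open>x < n\<close> by simp
      moreover have "0 \<in> cl {2..\<delta>}"
        using mod_mem_cl[of n "{2..\<delta>}"] assms \<open>\<delta> = n\<close> by simp
      ultimately show ?thesis
        using that \<open>\<delta> = n\<close> by (cases "x = 0"; cases "x = 1") auto
    qed
    ultimately show False using n_pos by simp
  qed
  moreover have "\<not> \<delta> + nu < n"
    using not_convex_zeros[OF *(3)] *(2) assms(1) by auto
  ultimately show ?R using assms(2) by linarith
next
  assume R: ?R
  then have \<delta>n: "\<delta> < n" using assms(1) by linarith
  have "0 \<notin> cl {2..\<delta>}"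
    using \<delta>n by (rule zero_not_mem_closure)
  have "co_neg (cl {2..\<delta>}) = {0}"
  proof (intro equalityI subsetI)
    fix j assume j: "j \<in> co_neg (cl {2..\<delta>})"
    then have "j < n" by (simp add: co_neg_def)
    show "j \<in> {0}"
    proof (rule ccontr)
      assume "j \<notin> {0}"
      then have "n - j \<in> cl {2..\<delta>}"
        using R \<delta>n \<open>j < n\<close> by (intro closure_nonzero) auto
      then show False
        using j co_neg_iff[of j "n - j"] \<open>j < n\<close> \<open>j \<notin> {0}\<close> by simp
    qed
  next
    fix j :: nat assume "j \<in> {0}"
    then show "j \<in> co_neg (cl {2..\<delta>})"
      using \<open>0 \<notin> cl {2..\<delta>}\<close> co_neg_iff[of 0 0] n_pos by simp
  qed
  \<comment> \<open>The witnesses are \<open>b' = n\<close> and \<open>\<delta>' = 2\<close>; 0 is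
    represented by \<open>n\<close> because \<open>b'\<close> must be positive.\<close>
  also have "{0} = cl {n..n + 2 - 2}"
    by (auto simp: cyc_closure_def)
  finally have "co_neg (cl {2..\<delta>}) = cl {n..n + 2 - 2}" .
  moreover have "2 \<le> n" "1 \<le> n"
    using assms by linarith+
  ultimately show ?L
    by blast
qed

text \<open>Grouping the summands by exponent: the number of \<open>t\<close> with exponent
  \<open>m - 1 - i\<close> is the balanced digit at position \<open>i\<close>.\<close>

lemma nu_eq_sum: "(q - 1) * nu = (\<Sum>t = 1..q - 1. q ^ (cdiv (q - 1) (m * t) - 1))"
proof -
  define s where "s = q - 1"
  have s_pos: "s > 0" using q_ge by (simp add: s_def)
  define p where "p = (\<lambda>t. cdiv s (m * t) - 1)"
  \<comment> \<open>\<open>t \<ge> 1\<close> makes the ceiling positive, so the truncated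
    subtraction in \<open>p\<close> is exact.\<close>
  have p_eq_iff: "p t = i \<longleftrightarrow> i * s < m * t \<and> m * t \<le> Suc i * s" if "t \<ge> 1" for t i
  proof -
    have "cdiv s (m * t) \<noteq> 0"
      using cdiv_le_iff[OF s_pos, of "m * t" 0] that m_pos by auto
    then have "p t = i \<longleftrightarrow> \<not> cdiv s (m * t) \<le> i \<and> cdiv s (m * t) \<le> Suc i"
      unfolding p_def by linarith
    then show ?thesis
      unfolding cdiv_le_iff[OF s_pos] by auto
  qed
  have fibre: "card {t \<in> {1..s}. p t = m - 1 - i} = balanced 1 i" if "i < m" for i
  proof -
    define d where "d = m - 1 - i"
    have d: "m = Suc d + i" using that by (simp add: d_def)
    \<comment> \<open>Reflection \<open>r\<close> to \<open>m - r\<close>: it turns the floors that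
      count the \<open>t\<close> below into the ceilings that define
      \<open>balanced\<close>.\<close>
    have fl: "cdiv m (r * (1 * s)) + (m - r) * s div m = s" if "r \<le> m" for r
    proof (rule antisym)
      have rs: "r * (1 * s) + (m - r) * s = s * m"
        using that by (simp add: mult.commute[of s] flip: add_mult_distrib)
      have "cdiv m (r * (1 * s)) + (m - r) * s div m \<le> cdiv m (r * (1 * s) + (m - r) * s)"
        by (rule le_cdiv_add[OF m_pos])
      also have "r * (1 * s) + (m - r) * s = 0 + s * m"
        using rs by simp
      also have "cdiv m (0 + s * m) = s"
        using cdiv_add_mult[OF m_pos, of 0 s] m_pos by (simp add: cdiv_def)
      finally show "cdiv m (r * (1 * s)) + (m - r) * s div m \<le> s" .
      have "(m - r) * s < ((m - r) * s div m + 1) * m"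
        using m_pos dividend_less_div_times[of m "(m - r) * s"] by simp
      moreover have "r * (1 * s) \<le> cdiv m (r * (1 * s)) * m"
        by (rule le_cdiv[OF m_pos])
      ultimately have "s * m < (cdiv m (r * (1 * s)) + (m - r) * s div m + 1) * m"
        using rs unfolding add_mult_distrib by linarith
      then have "s < cdiv m (r * (1 * s)) + (m - r) * s div m + 1"
        using mult_less_cancel2 by blast
      then show "s \<le> cdiv m (r * (1 * s)) + (m - r) * s div m"
        by linarith
    qed
    have "{t \<in> {1..s}. p t = d} = {d * s div m<..Suc d * s div m}"
    proof (intro equalityI subsetI)
      fix t assume "t \<in> {t \<in> {1..s}. p t = d}"
      then have "d * s < m * t" "m * t \<le> Suc d * s" using p_eq_iff by auto
      then show "t \<in> {d * s div m<..Suc d * s div m}"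
        using m_pos by (simp add: div_less_iff_less_mult less_eq_div_iff_mult_less_eq mult.commute)
    next
      fix t assume "t \<in> {d * s div m<..Suc d * s div m}"
      then have *: "d * s < m * t" "m * t \<le> Suc d * s"
        using m_pos by (auto simp: div_less_iff_less_mult less_eq_div_iff_mult_less_eq mult.commute)
      then have "t \<ge> 1" by (cases t) auto
      have "m * t \<le> m * s"
        using *(2) d by (metis le_add1 le_trans mult_le_mono1)
      then show "t \<in> {t \<in> {1..s}. p t = d}"
        using * \<open>t \<ge> 1\<close> p_eq_iff m_pos by auto
    qed
    then have "card {t \<in> {1..s}. p t = d} = Suc d * s div m - d * s div m"
      by simp
    also have "\<dots> = balanced 1 i"
    proof -
      have "cdiv m (i * (1 * s)) + Suc d * s div m = s" "cdiv m (Suc i * (1 * s)) + d * s div m = s"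
        using fl[of i] fl[of "Suc i"] d by auto
      then show ?thesis
        unfolding balanced_def s_def[symmetric] by linarith
    qed
    finally show ?thesis by (simp add: d_def)
  qed
  have p_less: "p t < m" if "t \<in> {1..s}" for t
  proof -
    have "cdiv s (m * t) \<le> m"
      unfolding cdiv_le_iff[OF s_pos] using that by simp
    then show ?thesis using m_pos by (simp add: p_def)
  qed
  have "(\<Sum>t = 1..s. q ^ p t) = (\<Sum>i<m. \<Sum>t\<in>{t \<in> {1..s}. m - 1 - p t = i}. q ^ p t)"
    using m_pos by (intro sum.group[symmetric]) auto
  also have "\<dots> = (\<Sum>i<m. balanced 1 i * q ^ (m - 1 - i))"
  proof (rule sum.cong[OF refl])
    fix i assume "i \<in> {..<m}"
    then have "{t \<in> {1..s}. m - 1 - p t = i} = {t \<in> {1..s}. p t = m - 1 - i}"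
      using p_less by fastforce
    then show "(\<Sum>t\<in>{t \<in> {1..s}. m - 1 - p t = i}. q ^ p t) = balanced 1 i * q ^ (m - 1 - i)"
      using fibre \<open>i \<in> {..<m}\<close> by simp
  qed
  also have "\<dots> = (q - 1) * nu"
    unfolding horner_sum[symmetric] by (rule horner_balanced_1)
  finally show ?thesis by (simp add: p_def s_def)
qed

end

subsection \<open>Cyclic codes given by their zeros\<close>

text \<open>\<open>range h\<close> is the fixed field of an additive Frobenius map, and
  \<open>of_nat_n\<close> makes Fourier inversion over \<open>n\<close> points free of
  denominators.\<close>

locale cyclic_code_setting = cyclotomic q m n
  for h :: "'k::field_gcd \<Rightarrow> 'l::field" and \<beta> :: 'l and q m n :: nat +
  assumes emb: "field_embedding h"
    and fixed_iff: "x ^ q = x \<longleftrightarrow> x \<in> range h"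
    and frob_add: "((x::'l) + y) ^ q = x ^ q + y ^ q"
    and of_nat_n: "of_nat n = (1::'l)"
    and beta_power_eq_1_iff: "\<beta> ^ i = 1 \<longleftrightarrow> n dvd i"
begin

lemma h_hom [simp]: "h 0 = 0" "h 1 = 1" "h (x + y) = h x + h y" "h (x * y) = h x * h y"
  using emb by (auto simp: field_embedding_def)

lemma h_sum: "h (sum f A) = (\<Sum>i\<in>A. h (f i))"
  by (induction A rule: infinite_finite_induct) auto

lemma h_eq_0_iff [simp]: "h x = 0 \<longleftrightarrow> x = 0"
proof
  assume "h x = 0"
  then have "h (x * inverse x) = 0" by simp
  then show "x = 0" by (cases "x = 0") auto
qed simp

lemma h_power_q [simp]: "h x ^ q = h x"
  using fixed_iff by blast

lemma q_pos: "q > 0"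
proof (rule ccontr)
  assume "\<not> q > 0"
  with frob_add[of 0 0] have "1 + 1 = (1 + 0 :: 'l)"
    by simp
  then show False
    unfolding add_left_cancel by simp
qed

lemma frob_sum: "(sum f A :: 'l) ^ q = (\<Sum>i\<in>A. f i ^ q)"
  using q_pos by (induction A rule: infinite_finite_induct) (auto simp: frob_add power_0_left)

lemma beta_n: "\<beta> ^ n = 1"
  by (simp add: beta_power_eq_1_iff)

lemma beta_mod: "\<beta> ^ (i mod n) = \<beta> ^ i"
proof -
  have "\<beta> ^ i = \<beta> ^ (n * (i div n) + i mod n)"
    by simp
  also have "\<dots> = \<beta> ^ (i mod n)"
    unfolding power_add power_mult by (simp add: beta_n)
  finally show ?thesis by simp
qed

lemma beta_cong: "[i = j] (mod n) \<Longrightarrow> \<beta> ^ i = \<beta> ^ j"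
  by (metis beta_mod cong_def)

lemma sum_beta_powers: "(\<Sum>i<n. (\<beta> ^ a) ^ i) = (if n dvd a then 1 else 0)"
proof (cases "n dvd a")
  case True
  then have "\<beta> ^ a = 1" by (simp add: beta_power_eq_1_iff)
  with True show ?thesis by (simp add: of_nat_n)
next
  case False
  then have "\<beta> ^ a \<noteq> 1" by (simp add: beta_power_eq_1_iff)
  moreover have "(\<beta> ^ a) ^ n = 1"
    by (metis beta_n power_mult mult.commute power_one)
  ultimately show ?thesis using False by (simp add: geometric_sum)
qed

section \<open>Evaluation through the embedding, and minimal polynomials\<close>

definition ev :: "'k poly \<Rightarrow> 'l \<Rightarrow> 'l" where
  "ev p x = poly (map_poly h p) x"

lemma ev_0 [simp]: "ev 0 x = 0"
  by (simp add: ev_def)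

lemma ev_pCons [simp]: "ev (pCons a p) x = h a + x * ev p x"
  by (cases "pCons a p = 0") (auto simp: ev_def map_poly_pCons)

lemma ev_add [simp]: "ev (p + r) x = ev p x + ev r x"
  by (induction p r rule: poly_induct2) (auto simp: algebra_simps)

lemma ev_smult [simp]: "ev (smult a p) x = h a * ev p x"
  by (induction p) (auto simp: algebra_simps)

lemma ev_diff [simp]: "ev (p - r) x = ev p x - ev r x"
  using ev_add[of "p - r" r x] by simp

lemma ev_mult [simp]: "ev (p * r) x = ev p x * ev r x"
  by (induction p) (auto simp: algebra_simps)

lemma ev_monom [simp]: "ev (monom a k) x = h a * x ^ k"
  by (simp add: ev_def map_poly_monom poly_monom)

lemma ev_1 [simp]: "ev 1 x = 1"
  using ev_monom[of 1 0 x] by simp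

lemma ev_altdef:
  assumes "degree p < n"
  shows "ev p x = (\<Sum>i<n. h (coeff p i) * x ^ i)"
proof -
  have deg: "degree (map_poly h p) \<le> degree p"
    by (rule map_poly_degree_leq)
  have "ev p x = (\<Sum>i\<le>degree (map_poly h p). coeff (map_poly h p) i * x ^ i)"
    unfolding ev_def by (rule poly_altdef)
  also have "\<dots> = (\<Sum>i<n. coeff (map_poly h p) i * x ^ i)"
    using deg assms by (intro sum.mono_neutral_left) (auto simp: coeff_eq_0)
  finally show ?thesis
    by (simp add: coeff_map_poly)
qed

lemma ev_frob: "ev p (x ^ q) = ev p x ^ q"
  by (induction p) (auto simp: frob_add power_mult_distrib q_pos power_0_left)

lemma ev_frob_power: "ev p (x ^ (q ^ k)) = ev p x ^ (q ^ k)"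
proof (induction k)
  case (Suc k)
  have eq: "y ^ (q ^ Suc k) = (y ^ q ^ k) ^ q" for y :: 'l
    by (simp add: mult.commute flip: power_mult)
  show ?case
    by (simp only: eq ev_frob Suc)
qed auto

text \<open>\<open>x ^ n = 1\<close> provides a nonzero annihilating polynomial. A monic one of
  least degree then exists and is unique, so the definite description in \<open>min_poly\<close>
  denotes it; division with remainder does the rest.\<close>

lemma min_poly_dvd_iff:
  assumes "x ^ n = 1"
  shows "min_poly h x dvd p \<longleftrightarrow> ev p x = 0"
proof -
  define Q where "Q = (\<lambda>r. r \<noteq> 0 \<and> ev r x = 0)"
  define P where "P = (\<lambda>p. lead_coeff p = 1 \<and> ev p x = 0 \<and> (\<forall>r. Q r \<longrightarrow> degree p \<le> degree r))"
  have "coeff (monom 1 n - 1 :: 'k poly) n = 1"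
    using n_pos by (cases n) auto
  then have "monom 1 n - 1 \<noteq> (0 :: 'k poly)"
    by (metis coeff_0 zero_neq_one)
  then have "Q (monom 1 n - 1)"
    using assms unfolding Q_def by (simp del: right_minus_eq)
  then obtain r where r: "Q r" "\<And>r'. Q r' \<Longrightarrow> degree r \<le> degree r'"
    using ex_has_least_nat[of Q _ degree] by blast
  define p0 where "p0 = smult (inverse (lead_coeff r)) r"
  have p0: "P p0"
    using r by (auto simp: P_def Q_def p0_def)
  have uniq: "p' = p0" if "P p'" for p'
  proof (rule ccontr)
    assume "p' \<noteq> p0"
    then have ne: "p' - p0 \<noteq> 0" by simp
    have deg: "degree p' = degree p0"
      using p0 that unfolding P_def Q_def
      by (metis le_antisym leading_coeff_0_iff one_neq_zero)
    have "Q (p' - p0)"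
      using ne p0 that by (simp add: P_def Q_def)
    then have "degree p0 \<le> degree (p' - p0)"
      using p0 by (auto simp: P_def)
    moreover have "coeff (p' - p0) (degree p0) = 0"
      using p0 that deg by (simp add: P_def)
    moreover have "degree (p' - p0) \<le> degree p0"
      using deg by (simp add: degree_diff_le)
    ultimately have "lead_coeff (p' - p0) = 0"
      by (metis le_antisym)
    then show False using ne leading_coeff_0_iff by blast
  qed
  have "min_poly h x = (THE p. P p)"
    unfolding min_poly_def P_def Q_def ev_def by (rule refl)
  then have "min_poly h x = p0"
    using the_equality[of P, OF p0 uniq] by simp
  moreover have "p0 dvd p" if "ev p x = 0"
  proof (rule ccontr)
    assume ndvd: "\<not> p0 dvd p"
    have p0_ne: "p0 \<noteq> 0" using p0 by (auto simp: P_def)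
    have "ev p x = ev (p div p0) x * ev p0 x + ev (p mod p0) x"
      by (metis div_mult_mod_eq ev_add ev_mult)
    then have "ev (p mod p0) x = 0"
      using that p0 by (simp add: P_def)
    moreover have ne: "p mod p0 \<noteq> 0" using ndvd by (simp add: dvd_eq_mod_eq_0)
    ultimately have "degree p0 \<le> degree (p mod p0)"
      using p0 by (auto simp: P_def Q_def)
    then show False
      using degree_mod_less'[OF p0_ne ne] by simp
  qed
  moreover have "ev p x = 0" if "p0 dvd p"
    using that p0 by (auto simp: P_def)
  ultimately show ?thesis by metis
qed

section \<open>Codes as sets of zeros\<close>

definition zero_code :: "nat set \<Rightarrow> 'k poly set" where
  "zero_code J = {c. degree c < n \<and> (\<forall>j\<in>J. ev c (\<beta> ^ j) = 0)}"

text \<open>The generator divides \<open>x ^ n - 1\<close>, so reduction modulo that polynomial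
  preserves divisibility by the generator; divisibility by the \<open>Lcm\<close> means vanishing at
  all the given powers.\<close>

lemma bch_code_eq: "bch_code h \<beta> n \<delta> b = zero_code {b..b + \<delta> - 2}"
proof -
  define J where "J = {b..b + \<delta> - 2}"
  define g where "g = Lcm ((\<lambda>j. min_poly h (\<beta> ^ j)) ` J)"
  define f :: "'k poly" where "f = monom 1 n - 1"
  have root: "(\<beta> ^ j) ^ n = 1" for j
    by (metis beta_n mult.commute power_mult power_one)
  have g_dvd: "g dvd p \<longleftrightarrow> (\<forall>j\<in>J. ev p (\<beta> ^ j) = 0)" for p
    unfolding g_def Lcm_dvd_iff by (simp add: min_poly_dvd_iff root)
  have gf: "g dvd f"
    unfolding g_dvd by (simp add: f_def root)
  have deg: "degree f = n"
  proof (rule order_antisym)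
    show "degree f \<le> n"
      unfolding f_def by (intro degree_diff_le) (auto simp: degree_monom_le)
    have "coeff f n = 1" using n_pos by (cases n) (auto simp: f_def)
    then show "n \<le> degree f" by (intro le_degree) auto
  qed
  have f_ne: "f \<noteq> 0" using deg n_pos by auto
  have "cyclic_code n g = {c. degree c < n \<and> g dvd c}"
  proof (intro equalityI subsetI)
    fix c assume "c \<in> cyclic_code n g"
    then obtain a where c: "c = (a * g) mod f"
      by (auto simp: cyclic_code_def f_def)
    have "degree c < n"
      unfolding c using degree_mod_less[OF f_ne, of "a * g"] deg n_pos by auto
    moreover have "g dvd c" unfolding c using gf by (simp add: dvd_mod)
    ultimately show "c \<in> {c. degree c < n \<and> g dvd c}" by simp
  next
    fix c assume "c \<in> {c. degree c < n \<and> g dvd c}"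
    then have c: "degree c < n" "g dvd c" by auto
    then have "c mod f = c" using deg by (simp add: mod_poly_less)
    moreover have "c = (c div g) * g" using c by simp
    ultimately show "c \<in> cyclic_code n g"
      unfolding cyclic_code_def f_def by (metis (mono_tags, lifting) mem_Collect_eq)
  qed
  then show ?thesis
    unfolding bch_code_def zero_code_def g_dvd J_def[symmetric] g_def[symmetric] by auto
qed

lemma ev_zero_cl:
  assumes "c \<in> zero_code J" "j \<in> cl J"
  shows "ev c (\<beta> ^ j) = 0"
proof -
  obtain i k where i: "i \<in> J" "[j = i * q ^ k] (mod n)"
    using assms(2) by (auto simp: cl_iff)
  have "ev c (\<beta> ^ j) = ev c ((\<beta> ^ i) ^ (q ^ k))"
    using beta_cong[OF i(2)] by (simp add: power_mult)
  also have "\<dots> = 0"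
    using assms(1) i(1) q_pos by (simp add: ev_frob_power zero_code_def)
  finally show ?thesis .
qed

lemma zero_code_cl: "zero_code (cl J) = zero_code J"
proof (intro equalityI subsetI)
  fix c assume c: "c \<in> zero_code (cl J)"
  show "c \<in> zero_code J"
    unfolding zero_code_def
  proof (intro CollectI conjI ballI)
    show "degree c < n" using c by (simp add: zero_code_def)
    fix j assume "j \<in> J"
    then have "ev c (\<beta> ^ (j mod n)) = 0"
      using c mod_mem_cl by (auto simp: zero_code_def)
    then show "ev c (\<beta> ^ j) = 0" by (simp add: beta_mod)
  qed
qed (use ev_zero_cl in \<open>auto simp: zero_code_def\<close>)

text \<open>Fourier inversion of the prescribed spectrum gives the coefficients \<open>w i\<close>.
  As \<open>A\<close> is closed under multiplication by \<open>q\<close>, the Frobenius map permutes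
  the terms of \<open>w i\<close>, so these coefficients come from the small field.\<close>

lemma exists_transform:
  assumes A: "A \<subseteq> {..<n}" "\<And>a. a \<in> A \<Longrightarrow> a * q mod n \<in> A"
  shows "\<exists>c. degree c < n \<and> (\<forall>j<n. ev c (\<beta> ^ j) = (if j \<in> A then \<beta> ^ (j * s) else 0))"
proof -
  have fin: "finite A" using A(1) finite_subset by blast
  have inj: "inj_on (\<lambda>a. a * q mod n) A"
  proof (rule inj_onI)
    fix a b assume ab: "a \<in> A" "b \<in> A" "a * q mod n = b * q mod n"
    have "[b * q = a * q ^ 1] (mod n)"
      using ab(3) by (simp add: cong_def)
    from cong_q_power_invert[OF this] have 1: "[a = b * q * q ^ (m - 1)] (mod n)"
      by simp
    have "[b = b * q * q ^ (m - 1)] (mod n)"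
      using cong_q_power_invert[of "b * q" b 1] by simp
    with 1 have "[a = b] (mod n)"
      using cong_sym cong_trans by blast
    moreover have "a < n" "b < n"
      using ab(1,2) A(1) by auto
    ultimately show "a = b"
      by (simp add: cong_def)
  qed
  have img: "(\<lambda>a. a * q mod n) ` A = A"
    using A(2) inj fin by (intro endo_inj_surj) auto
  define w where "w = (\<lambda>i. \<Sum>a\<in>A. \<beta> ^ (a * (s + (n - 1) * i)))"
  have "w i ^ q = w i" for i
  proof -
    let ?u = "s + (n - 1) * i"
    have "w i ^ q = (\<Sum>a\<in>A. \<beta> ^ (a * q mod n * ?u))"
      unfolding w_def frob_sum
    proof (rule sum.cong[OF refl])
      fix a
      have "[a * ?u * q = a * q mod n * ?u] (mod n)"
        by (simp add: cong_def mod_mult_left_eq mult_ac)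
      then show "(\<beta> ^ (a * ?u)) ^ q = \<beta> ^ (a * q mod n * ?u)"
        using beta_cong by (simp flip: power_mult)
    qed
    also have "\<dots> = (\<Sum>a\<in>A. \<beta> ^ (a * ?u))"
      using sum.reindex[OF inj, of "\<lambda>a. \<beta> ^ (a * ?u)"] img by simp
    finally show ?thesis by (simp add: w_def)
  qed
  then have "\<exists>a. h a = w i" for i
    using fixed_iff[of "w i"] by auto
  then obtain co where co: "\<And>i. h (co i) = w i"
    by metis
  define c where "c = (\<Sum>i<n. monom (co i) i)"
  have coeff_c: "coeff c i = (if i < n then co i else 0)" for i
    by (simp add: c_def coeff_sum coeff_monom)
  have deg: "degree c < n"
  proof -
    have "degree c \<le> n - 1"
      by (rule degree_le) (use coeff_c in auto)
    then show ?thesis using n_pos by simp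
  qed
  have "ev c (\<beta> ^ j) = (if j \<in> A then \<beta> ^ (j * s) else 0)" if j: "j < n" for j
  proof -
    have "ev c (\<beta> ^ j) = (\<Sum>i<n. w i * (\<beta> ^ j) ^ i)"
      by (simp add: ev_altdef[OF deg] coeff_c co)
    also have "\<dots> = (\<Sum>i<n. \<Sum>a\<in>A. \<beta> ^ (a * s) * (\<beta> ^ ((n - 1) * a + j)) ^ i)"
      unfolding w_def sum_distrib_right
      by (intro sum.cong refl) (simp add: add_mult_distrib add_mult_distrib2 ac_simps flip: power_mult power_add)
    also have "\<dots> = (\<Sum>a\<in>A. \<beta> ^ (a * s) * (\<Sum>i<n. (\<beta> ^ ((n - 1) * a + j)) ^ i))"
      by (subst sum.swap) (simp add: sum_distrib_left)
    also have "\<dots> = (\<Sum>a\<in>A. if a = j then \<beta> ^ (j * s) else 0)"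
    proof (intro sum.cong refl)
      fix a assume "a \<in> A"
      then have a: "a < n" using A(1) by auto
      have "n dvd (n - 1) * a + j \<longleftrightarrow> a = j"
      proof
        assume "n dvd (n - 1) * a + j"
        then show "a = j" using neg_unique dvd_pred_mult_add a j by blast
      next
        assume "a = j"
        then show "n dvd (n - 1) * a + j"
          using dvd_pred_mult_add[of j] by simp
      qed
      then show "\<beta> ^ (a * s) * (\<Sum>i<n. (\<beta> ^ ((n - 1) * a + j)) ^ i)
          = (if a = j then \<beta> ^ (j * s) else 0)"
        by (simp only: sum_beta_powers) auto
    qed
    also have "\<dots> = (if j \<in> A then \<beta> ^ (j * s) else 0)"
      using fin by simp
    finally show ?thesis .
  qed
  with deg show ?thesis by blast
qed

text \<open>With \<open>s = 0\<close> the spectrum is the indicator of the complement of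
  \<open>cl J\<close>: a code word with no zero exponents below \<open>n\<close> except those in
  \<open>cl J\<close>.\<close>

lemma cl_mono_of_zero_code:
  assumes "zero_code J \<subseteq> zero_code J'"
  shows "cl J' \<subseteq> cl J"
proof
  fix j assume j: "j \<in> cl J'"
  define A where "A = {..<n} - cl J"
  have "a * q mod n \<in> A" if "a \<in> A" for a
    using that cl_of_mult[of a 1 J] n_pos by (auto simp: A_def)
  then obtain c where c: "degree c < n"
      "\<forall>j<n. ev c (\<beta> ^ j) = (if j \<in> A then \<beta> ^ (j * 0) else 0)"
    using exists_transform[of A 0] by (auto simp: A_def)
  have "c \<in> zero_code (cl J)"
    using c cl_less by (auto simp: zero_code_def A_def)
  then have "c \<in> zero_code J'"
    using assms by (simp add: zero_code_cl subset_iff)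
  then have "ev c (\<beta> ^ j) = 0"
    using j ev_zero_cl by blast
  then show "j \<in> cl J"
    using c(2) cl_less[OF j] by (auto simp: A_def split: if_splits)
qed

lemma zero_code_eq_iff: "zero_code J = zero_code J' \<longleftrightarrow> cl J = cl J'"
  by (metis cl_mono_of_zero_code zero_code_cl order_refl subset_antisym)

text \<open>No factor \<open>1 / n\<close> occurs since \<open>n = 1\<close> in the field.\<close>

lemma parseval:
  assumes "degree c < n" "degree d < n"
  shows "h (\<Sum>i<n. coeff c i * coeff d i) = (\<Sum>j<n. ev c (\<beta> ^ j) * ev d (\<beta> ^ ((n - 1) * j)))"
proof -
  let ?c = "\<lambda>i. h (coeff c i)" and ?d = "\<lambda>i. h (coeff d i)"
  have "(\<Sum>j<n. ev c (\<beta> ^ j) * ev d (\<beta> ^ ((n - 1) * j)))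
      = (\<Sum>j<n. \<Sum>i<n. \<Sum>l<n. ?c i * ?d l * (\<beta> ^ ((n - 1) * l + i)) ^ j)"
    unfolding ev_altdef[OF assms(1)] ev_altdef[OF assms(2)] sum_product
    by (intro sum.cong refl) (simp add: add_mult_distrib add_mult_distrib2 ac_simps flip: power_mult power_add)
  also have "\<dots> = (\<Sum>i<n. \<Sum>l<n. \<Sum>j<n. ?c i * ?d l * (\<beta> ^ ((n - 1) * l + i)) ^ j)"
    by (subst sum.swap, rule sum.cong[OF refl], rule sum.swap)
  also have "\<dots> = (\<Sum>i<n. \<Sum>l<n. if l = i then ?c i * ?d i else 0)"
  proof (intro sum.cong refl)
    fix i l assume "i \<in> {..<n}" "l \<in> {..<n}"
    then have il: "i < n" "l < n" by auto
    have "n dvd (n - 1) * l + l"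
      by (rule dvd_pred_mult_add)
    then have "n dvd (n - 1) * l + i \<longleftrightarrow> l = i"
      using neg_unique il by blast
    then show "(\<Sum>j<n. ?c i * ?d l * (\<beta> ^ ((n - 1) * l + i)) ^ j)
        = (if l = i then ?c i * ?d i else 0)"
      by (simp only: sum_beta_powers flip: sum_distrib_left) auto
  qed
  also have "\<dots> = (\<Sum>i<n. ?c i * ?d i)"
    by simp
  finally show ?thesis by (simp add: h_sum)
qed

text \<open>By \<open>parseval\<close> the inner product pairs the spectrum of \<open>c\<close> at
  \<open>j\<close> with that of \<open>d\<close> at \<open>-j\<close>. The stated zeros make every
  term vanish; conversely, enough test words force them.\<close>

lemma dual_zero_code: "dual_code n (zero_code J) = zero_code (co_neg (cl J))"
proof (intro equalityI subsetI)
  fix d assume d: "d \<in> zero_code (co_neg (cl J))"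
  then have deg: "degree d < n" by (simp add: zero_code_def)
  have "(\<Sum>i<n. coeff c i * coeff d i) = 0" if c: "c \<in> zero_code J" for c
  proof -
    have "ev c (\<beta> ^ j) * ev d (\<beta> ^ ((n - 1) * j)) = 0" if "j < n" for j
    proof (cases "j \<in> cl J")
      case True
      then show ?thesis using ev_zero_cl[OF c] by simp
    next
      case False
      have "(n - 1) * j mod n \<in> co_neg (cl J)"
        using co_neg_iff[of "(n - 1) * j mod n" j] False \<open>j < n\<close> n_pos dvd_add_neg[of j]
        by (simp add: add.commute)
      then have "ev d (\<beta> ^ ((n - 1) * j mod n)) = 0"
        using d unfolding zero_code_def by blast
      then show ?thesis by (simp add: beta_mod)
    qed
    then have "h (\<Sum>i<n. coeff c i * coeff d i) = 0"
      using c deg by (subst parseval) (auto simp: zero_code_def intro!: sum.neutral)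
    then show ?thesis by simp
  qed
  with deg show "d \<in> dual_code n (zero_code J)" by (simp add: dual_code_def)
next
  fix d assume d: "d \<in> dual_code n (zero_code J)"
  then have deg: "degree d < n" by (simp add: dual_code_def)
  define A where "A = {..<n} - cl J"
  define D where "D = (\<lambda>j. ev d (\<beta> ^ ((n - 1) * j)))"
  have closed: "a * q mod n \<in> A" if "a \<in> A" for a
    using that cl_of_mult[of a 1 J] n_pos by (auto simp: A_def)
  \<comment> \<open>Spectra of words over the small field are constrained along cosets, so an
    exponent is not tested alone: all twists by \<open>s\<close> are collected and inverted in
    \<open>D0\<close>.\<close>
  have sum0: "(\<Sum>j\<in>A. \<beta> ^ (j * s) * D j) = 0" for s
  proof -
    obtain c where c: "degree c < n"
        "\<forall>j<n. ev c (\<beta> ^ j) = (if j \<in> A then \<beta> ^ (j * s) else 0)"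
      using exists_transform[of A s] closed by (auto simp: A_def)
    have "c \<in> zero_code (cl J)"
      using c cl_less by (auto simp: zero_code_def A_def)
    then have "(\<Sum>i<n. coeff c i * coeff d i) = 0"
      using d by (simp add: zero_code_cl dual_code_def)
    then have "0 = (\<Sum>j<n. ev c (\<beta> ^ j) * D j)"
      using parseval[OF c(1) deg] by (simp add: D_def)
    also have "\<dots> = (\<Sum>j\<in>A. ev c (\<beta> ^ j) * D j)"
      by (rule sum.mono_neutral_right) (auto simp: A_def c(2))
    also have "\<dots> = (\<Sum>j\<in>A. \<beta> ^ (j * s) * D j)"
      using c(2) by (intro sum.cong) (auto simp: A_def)
    finally show ?thesis by simp
  qed
  have D0: "D b = 0" if b: "b \<in> A" for b
  proof -
    have bn: "b < n" using b by (auto simp: A_def)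
    \<comment> \<open>Weighting by the power of \<open>\<beta>\<close> with exponent
      \<open>-b * s\<close> and summing over \<open>s\<close> isolates the term
      \<open>j = b\<close>.\<close>
    have "0 = (\<Sum>s<n. \<beta> ^ ((n - 1) * b * s) * (\<Sum>j\<in>A. \<beta> ^ (j * s) * D j))"
      by (simp add: sum0)
    also have "\<dots> = (\<Sum>s<n. \<Sum>j\<in>A. D j * (\<beta> ^ ((n - 1) * b + j)) ^ s)"
      unfolding sum_distrib_left
      by (intro sum.cong refl) (simp add: add_mult_distrib add_mult_distrib2 ac_simps flip: power_mult power_add)
    also have "\<dots> = (\<Sum>j\<in>A. D j * (\<Sum>s<n. (\<beta> ^ ((n - 1) * b + j)) ^ s))"
      by (subst sum.swap) (simp add: sum_distrib_left)
    also have "\<dots> = (\<Sum>j\<in>A. if j = b then D b else 0)"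
    proof (intro sum.cong refl)
      fix j assume "j \<in> A"
      then have "j < n" by (simp add: A_def)
      have "n dvd (n - 1) * b + b"
        by (rule dvd_pred_mult_add)
      then have "n dvd (n - 1) * b + j \<longleftrightarrow> j = b"
        using neg_unique bn \<open>j < n\<close> by blast
      then show "D j * (\<Sum>s<n. (\<beta> ^ ((n - 1) * b + j)) ^ s) = (if j = b then D b else 0)"
        by (simp only: sum_beta_powers) auto
    qed
    also have "\<dots> = D b"
      using b by (simp add: A_def)
    finally show ?thesis by simp
  qed
  have "ev d (\<beta> ^ j) = 0" if j: "j \<in> co_neg (cl J)" for j
  proof -
    let ?b = "(n - 1) * j mod n"
    have "?b \<in> A" using j n_pos by (auto simp: co_neg_def A_def)
    then have "D ?b = 0" by (rule D0)
    moreover have "(n - 1) * ?b mod n = j"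
    proof (rule neg_unique)
      show "n dvd ?b + (n - 1) * ?b mod n" by (rule dvd_add_neg)
      show "n dvd ?b + j" using dvd_add_neg[of j] by (simp add: add.commute)
    qed (use j n_pos in \<open>auto simp: co_neg_def\<close>)
    ultimately show ?thesis
      using beta_mod[of "(n - 1) * ?b"] by (simp add: D_def)
  qed
  with deg show "d \<in> zero_code (co_neg (cl J))" by (simp add: zero_code_def)
qed

lemma dually_bch_iff:
  "dually_bch h \<beta> n (bch_code h \<beta> n \<delta> b) \<longleftrightarrow>
    (\<exists>\<delta>' b'. 2 \<le> \<delta>' \<and> \<delta>' \<le> n \<and> 1 \<le> b' \<and>
      co_neg (cl {b..b + \<delta> - 2}) = cl {b'..b' + \<delta>' - 2})"
  by (simp add: dually_bch_def bch_code_eq dual_zero_code zero_code_eq_iff cl_co_neg)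

end

subsection \<open>Finite fields\<close>

text \<open>Multiplication by a nonzero \<open>x\<close> permutes the nonzero elements; comparing
  their products gives \<open>x ^ (CARD('a) - 1) = 1\<close>.\<close>

lemma field_power_card:
  fixes x :: "'a::field"
  assumes "CARD('a) > 0"
  shows "x ^ CARD('a) = x"
proof (cases "x = 0")
  case False
  have fin: "finite (UNIV :: 'a set)"
    using assms card_ge_0_finite by blast
  have "(\<Prod>y\<in>UNIV - {0}. x * y) = (\<Prod>y\<in>UNIV - {0}. y)"
    by (rule prod.reindex_bij_witness[of _ "\<lambda>y. y / x" "\<lambda>y. x * y"]) (use False in auto)
  then have "x ^ (CARD('a) - 1) * \<Prod>(UNIV - {0}) = 1 * \<Prod>(UNIV - {0 :: 'a})"
    using fin by (simp add: prod.distrib card_Diff_singleton)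
  moreover have "\<Prod>(UNIV - {0 :: 'a}) \<noteq> 0"
    using fin by simp
  ultimately have "x ^ (CARD('a) - 1) = 1"
    using mult_right_cancel by blast
  then show ?thesis
    using assms by (metis Suc_pred' mult_1 power_Suc2)
qed (use assms in auto)

text \<open>Translation by 1 permutes the field, so it leaves the sum of all elements
  unchanged.\<close>

lemma of_nat_card_field:
  assumes "CARD('a::field) > 0"
  shows "of_nat CARD('a) = (0 :: 'a)"
proof -
  have "(\<Sum>y\<in>UNIV. y + 1) = (\<Sum>y\<in>UNIV. (y :: 'a))"
    by (rule sum.reindex_bij_witness[of _ "\<lambda>y. y - 1" "\<lambda>y. y + 1"]) auto
  then show ?thesis by (simp add: sum.distrib)
qed

lemma CHAR_eq_prime:
  assumes "prime p" "CARD('a::field) = p ^ r"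
  shows "CHAR('a) = p"
proof -
  have card: "CARD('a) > 0"
    using assms by (simp add: prime_gt_0_nat)
  then have "of_nat (p ^ r) = (0 :: 'a)"
    using of_nat_card_field assms(2) by metis
  then have dvd: "CHAR('a) dvd p ^ r"
    by (simp only: of_nat_eq_0_iff_char_dvd)
  have "finite (UNIV :: 'a set)"
    using card card_ge_0_finite by blast
  then have "CHAR('a) > 0"
    by (rule finite_imp_CHAR_pos)
  then have prime: "prime CHAR('a)"
    by (rule prime_CHAR_semidom)
  then have "CHAR('a) dvd p"
    using dvd by (rule prime_dvd_power)
  with prime assms(1) show ?thesis
    by (rule primes_dvd_imp_eq)
qed

text \<open>The \<open>q\<close> elements of \<open>range h\<close> are roots of
  \<open>X ^ q - X\<close>, which has at most \<open>q\<close> roots.\<close>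

lemma range_field_embedding:
  fixes h :: "'k::field \<Rightarrow> 'l::field"
  assumes emb: "field_embedding h" and "CARD('k) = q" "q \<ge> 2"
  shows "x ^ q = x \<longleftrightarrow> x \<in> range h"
proof -
  have hom: "h 0 = 0" "h 1 = 1" "\<And>x y. h (x + y) = h x + h y" "\<And>x y. h (x * y) = h x * h y"
    using emb by (auto simp: field_embedding_def)
  have h_power: "h (a ^ k) = h a ^ k" for a k
    by (induction k) (auto simp: hom)
  have inj: "inj h"
  proof (rule injI)
    fix a b assume ab: "h a = h b"
    have "h (a - b) + h b = h a"
      using hom(3)[of "a - b" b] by simp
    then have 0: "h (a - b) = 0" using ab by simp
    show "a = b"
    proof (rule ccontr)
      assume "a \<noteq> b"
      then have "h ((a - b) * inverse (a - b)) = 1"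
        by (simp add: hom(2))
      then show False using 0 by (simp only: hom(4)) simp
    qed
  qed
  define p :: "'l poly" where "p = monom 1 q - monom 1 1"
  have p: "coeff p q = 1" "degree p \<le> q"
    using assms(3) by (auto simp: p_def degree_monom_eq intro!: degree_diff_le)
  then have "p \<noteq> 0" by auto
  have set_eq: "{x. poly p x = 0} = {x. x ^ q = x}"
    by (auto simp: p_def poly_monom)
  have "card {x::'l. x ^ q = x} \<le> card (range h)"
    using card_poly_roots_bound[OF \<open>p \<noteq> 0\<close>] p(2) assms(2) inj
    by (simp add: set_eq card_image)
  moreover have "finite {x::'l. x ^ q = x}"
    using poly_roots_finite[OF \<open>p \<noteq> 0\<close>] by (simp add: set_eq)
  moreover have "h y ^ q = h y" for y
  proof -
    have "y ^ CARD('k) = y"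
      using assms(2,3) by (intro field_power_card) simp
    then show ?thesis
      using h_power[of y q] assms(2) by simp
  qed
  then have "range h \<subseteq> {x. x ^ q = x}" by auto
  ultimately have "range h = {x. x ^ q = x}"
    by (metis card_seteq)
  then show ?thesis by blast
qed

text \<open>The \<open>N\<close> nonzero elements are all powers with exponent below
  \<open>N\<close>, so these powers are distinct.\<close>

lemma generates_units_power_eq_1_iff:
  fixes \<alpha> :: "'a::field"
  assumes gen: "generates_units \<alpha>" and card: "CARD('a) = N + 1" and "N > 0"
  shows "\<alpha> ^ i = 1 \<longleftrightarrow> N dvd i"
proof -
  have "\<alpha> \<noteq> 0" using gen by (simp add: generates_units_def)
  have "\<alpha> ^ CARD('a) = \<alpha>"
    using card by (intro field_power_card) simp
  then have one: "\<alpha> ^ N = 1"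
    using \<open>\<alpha> \<noteq> 0\<close> by (simp add: card)
  have mod: "\<alpha> ^ i = \<alpha> ^ (i mod N)" for i
  proof -
    have "\<alpha> ^ i = \<alpha> ^ (N * (i div N) + i mod N)" by simp
    then show ?thesis
      unfolding power_add power_mult one by simp
  qed
  have fin: "finite (UNIV :: 'a set)"
    using card card_ge_0_finite by force
  have "UNIV - {0} \<subseteq> (\<lambda>k. \<alpha> ^ k) ` {..<N}"
  proof
    fix x :: 'a assume "x \<in> UNIV - {0}"
    then obtain k where "x = \<alpha> ^ k" using gen by (auto simp: generates_units_def)
    then have "x = \<alpha> ^ (k mod N)" using mod by metis
    then show "x \<in> (\<lambda>k. \<alpha> ^ k) ` {..<N}" using \<open>N > 0\<close> by auto
  qed
  then have "card (UNIV - {0 :: 'a}) \<le> card ((\<lambda>k. \<alpha> ^ k) ` {..<N})"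
    by (intro card_mono) auto
  moreover have "card (UNIV - {0 :: 'a}) = N"
    using fin card by (simp add: card_Diff_singleton)
  ultimately have "card ((\<lambda>k. \<alpha> ^ k) ` {..<N}) = card {..<N}"
    using card_image_le[of "{..<N}" "\<lambda>k. \<alpha> ^ k"] by simp
  then have inj: "inj_on (\<lambda>k. \<alpha> ^ k) {..<N}"
    by (intro eq_card_imp_inj_on) auto
  have "\<alpha> ^ i = 1 \<longleftrightarrow> \<alpha> ^ (i mod N) = \<alpha> ^ 0"
    using mod[of i] by simp
  also have "\<dots> \<longleftrightarrow> i mod N = 0"
    using inj_on_eq_iff[OF inj, of "i mod N" 0] \<open>N > 0\<close> by simp
  finally show ?thesis by (simp add: dvd_eq_mod_eq_0)
qed

section \<open>The bound in real arithmetic, and the characterization\<close>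

lemma powi_ceiling_eq:
  assumes "s > 0" "a > 0"
  shows "real q powi \<lceil>real a / real s - 1\<rceil> = real (q ^ (cdiv s a - 1))"
proof -
  define c where "c = cdiv s a - 1"
  have "cdiv s a \<noteq> 0"
    using cdiv_le_iff[OF assms(1), of a 0] assms(2) by auto
  then have c: "cdiv s a = Suc c" by (simp add: c_def)
  have 1: "a \<le> Suc c * s" using le_cdiv[OF assms(1), of a] c by simp
  have 2: "c * s < a" using cdiv_le_iff[OF assms(1), of a c] c by simp
  have "real a \<le> real (Suc c * s)" "real (c * s) < real a"
    using 1 2 of_nat_le_iff of_nat_less_iff by blast+
  then have "real a \<le> (real c + 1) * real s" "real c * real s < real a"
    by (simp_all add: algebra_simps)
  then have "real a / real s \<le> real c + 1" "real c < real a / real s"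
    using assms(1) by (simp_all add: pos_divide_le_eq pos_less_divide_eq)
  then have "\<lceil>real a / real s - 1\<rceil> = int c"
    by (intro ceiling_unique) auto
  then show ?thesis by (simp add: c_def)
qed

lemma (in bch_length) bound_le_iff:
  "(real q ^ m - 1 - (\<Sum>t = 1..q - 1. real q powi \<lceil>real (m * t) / real (q - 1) - 1\<rceil>))
      / real (q - 1) \<le> real \<delta> \<longleftrightarrow> n \<le> \<delta> + nu"
proof -
  define s where "s = q - 1"
  have s: "s > 0" using q_ge by (simp add: s_def)
  have "(\<Sum>t = 1..s. real q powi \<lceil>real (m * t) / real s - 1\<rceil>)
      = (\<Sum>t = 1..s. real (q ^ (cdiv s (m * t) - 1)))"
    using s m_pos by (intro sum.cong refl powi_ceiling_eq) auto
  also have "\<dots> = real (s * nu)"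
    using nu_eq_sum by (simp add: s_def)
  finally have sum: "(\<Sum>t = 1..s. real q powi \<lceil>real (m * t) / real s - 1\<rceil>) = real s * real nu"
    by simp
  have "real (q ^ m) = real (n * s + 1)"
    using n_eq by (simp add: s_def)
  then have qm: "real q ^ m - 1 = real s * real n"
    by (simp add: mult.commute)
  have "(real s * real n - real s * real nu) / real s = real n - real nu"
    using s by (simp flip: right_diff_distrib)
  then show ?thesis
    unfolding s_def[symmetric] sum qm by linarith
qed

theorem theorem36:
  fixes h :: "'k::field_gcd \<Rightarrow> 'l::field" and \<alpha> \<beta> :: 'l and q m n \<delta> :: nat
  assumes "primepow q" and "q \<ge> 3" and "m \<ge> 4"
    and "CARD('k) = q" and "CARD('l) = q ^ m" and "field_embedding h"
    and "generates_units \<alpha>" and "\<beta> = \<alpha> ^ (q - 1)"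
    and "n = (q ^ m - 1) div (q - 1)"
    and "2 \<le> \<delta>" and "\<delta> \<le> n"
  shows "dually_bch h \<beta> n (bch_code h \<beta> n \<delta> 2) \<longleftrightarrow>
    (real q ^ m - 1 - (\<Sum>t = 1..q - 1. real q powi \<lceil>real (m * t) / real (q - 1) - 1\<rceil>))
      / real (q - 1) \<le> real \<delta> \<and> \<delta> \<le> n - 1"
proof -
  obtain u where u: "(q - 1) * u + 1 = q ^ m"
    using repunit_exists[of q] assms(2) by auto
  have "n = u"
    using assms(2,9) by (simp flip: u)
  then have n_eq: "n * (q - 1) + 1 = q ^ m"
    using u by (simp add: mult.commute)
  interpret bch_length q m n
    by unfold_locales (use assms n_eq in auto)
  obtain p r where p: "prime p" "q = p ^ r"
    using assms(1) by (auto simp: primepow_def)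
  have char: "CHAR('l) = p"
    using CHAR_eq_prime[of p "r * m", where ?'a = 'l] p assms(5) by (simp add: power_mult)
  have "p dvd q"
    using p assms(2) by (cases r) auto
  then have q0: "of_nat q = (0 :: 'l)"
    by (simp add: of_nat_eq_0_iff_char_dvd char)
  \<comment> \<open>In the field \<open>'l\<close>, where \<open>q\<close> vanishes, this equation
    reads \<open>1 = n\<close>.\<close>
  have "n * q + 1 = q ^ m + n"
    unfolding n_eq[symmetric] using assms(2) by (cases q) auto
  then have "of_nat (n * q + 1) = (of_nat (q ^ m + n) :: 'l)"
    by (rule arg_cong)
  then have of_nat_n: "of_nat n = (1 :: 'l)"
    using q0 m_pos by (simp add: power_0_left)
  have "\<alpha> ^ i = 1 \<longleftrightarrow> n * (q - 1) dvd i" for i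
    using generates_units_power_eq_1_iff[OF assms(7), of "n * (q - 1)"] assms(2,5) n_eq n_pos
    by simp
  then have beta: "\<beta> ^ i = 1 \<longleftrightarrow> n dvd i" for i
    using assms(2) by (simp add: assms(8) mult.commute[of n] flip: power_mult)
  interpret cyclic_code_setting h \<beta> q m n
  proof
    show "x ^ q = x \<longleftrightarrow> x \<in> range h" for x
      using assms(2,4,6) by (intro range_field_embedding) auto
    show "(x + y) ^ q = x ^ q + y ^ q" for x y :: 'l
      using p by (intro freshmans_dream') (auto simp: char)
  qed (use assms(6) of_nat_n beta in auto)
  show ?thesis
    unfolding dually_bch_iff bound_le_iff
    using co_neg_convex_iff[OF assms(10,11)] by simp
qed

end
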